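(* Every forest is inertia-convex on stripes.
   Context: All graphs are finite, simple and undirected. For a graph $G=(V,E)$ with vertex set $V=\{1,\ldots,n\}$, $\mathcal{S}(G)$ is the set of all real symmetric $n\times n$ matrices $A=[a_{ij}]$ such that for $i\neq j$, $a_{ij}\neq 0$ if and only if $ij\in E$ (no condition on the diagonal entries). The partial inertia of a Hermitian matrix $A$ is $\operatorname{pin}(A)=(\pi(A),\nu(A))$, where $\pi(A)$ and $\nu(A)$ are the numbers of positive and of negative eigenvalues of $A$, counted with multiplicity. The minimum rank $\operatorname{mr}(G)$ is the minimum of $\operatorname{rank} A$ over $A\in\mathcal{S}(G)$. A stripe of rank $m$ is a nonempty set $S$ of ordered pairs of nonnegative integers such that $(r,s)\in S$ implies $(s,r)\in S$, and $r+s=m$ for every $(r,s)\in S$. A stripe $S$ is convex if its projection $\{r : (r,s)\in S\}$ is a set of consecutive integers. For any graph $G$ of order $n$ and any integer $m$ with $\operatorname{mr}(G)\le m\le n$, the set $\{\operatorname{pin}(A) : A\in\mathcal{S}(G),\ \operatorname{rank}A=m\}$ is a stripe of rank $m$. The graph $G$ is inertia-convex on stripes if each of these stripes ($\operatorname{mr}(G)\le m\le n$) is convex. *)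

theory Defs
  imports
    "Graph_Theory.Pair_Digraph"
    "Jordan_Normal_Form.Char_Poly"
    "Jordan_Normal_Form.DL_Rank"
begin

text \<open>
  A finite simple undirected graph of order \<open>n\<close> is a \<open>pair_graph\<close> (a finite, loopless, symmetric
  set of pairs as arcs) with vertex set \<open>{0..<n}\<close>, so that the vertices are exactly the row and
  column indices of \<open>n\<close>-by-\<open>n\<close> matrices.
\<close>

definition graph_on :: "nat \<Rightarrow> nat pair_pre_digraph \<Rightarrow> bool" where
  "graph_on n G \<longleftrightarrow> pair_graph G \<and> pverts G = {0..<n}"

text \<open>
  An edge \<open>uv\<close> of an undirected graph is a pair of opposite arcs, so the closed walk \<open>u, v, u\<close>
  is a \<open>cycle\<close> of the symmetric digraph.  It is not a cycle of the undirected
  graph, whence the bound on the length.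
\<close>

definition undirected_forest :: "'a pair_pre_digraph \<Rightarrow> bool" where
  "undirected_forest G \<longleftrightarrow> \<not> (\<exists>p. pre_digraph.cycle (with_proj G) p \<and> 3 \<le> length p)"

definition graph_matrices :: "nat \<Rightarrow> nat pair_pre_digraph \<Rightarrow> real mat set" where
  "graph_matrices n G =
     {A \<in> carrier_mat n n. transpose_mat A = A \<and>
        (\<forall>i<n. \<forall>j<n. i \<noteq> j \<longrightarrow> (A $$ (i, j) \<noteq> 0 \<longleftrightarrow> (i, j) \<in> parcs G))}"

text \<open>Eigenvalues are counted with their multiplicity as roots of the characteristic polynomial.\<close>

definition pos_inertia :: "real mat \<Rightarrow> nat" where
  "pos_inertia A = (\<Sum>x | eigenvalue A x \<and> x > 0. Polynomial.order x (char_poly A))"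

definition neg_inertia :: "real mat \<Rightarrow> nat" where
  "neg_inertia A = (\<Sum>x | eigenvalue A x \<and> x < 0. Polynomial.order x (char_poly A))"

definition pin :: "real mat \<Rightarrow> nat \<times> nat" where
  "pin A = (pos_inertia A, neg_inertia A)"

definition min_rank :: "nat \<Rightarrow> nat pair_pre_digraph \<Rightarrow> nat" where
  "min_rank n G = (LEAST k. \<exists>A \<in> graph_matrices n G. vec_space.rank n A = k)"

definition stripe :: "nat \<Rightarrow> (nat \<times> nat) set \<Rightarrow> bool" where
  "stripe m S \<longleftrightarrow> S \<noteq> {} \<and> (\<forall>(r, s) \<in> S. (s, r) \<in> S \<and> r + s = m)"

definition convex_stripe :: "nat \<Rightarrow> (nat \<times> nat) set \<Rightarrow> bool" where
  "convex_stripe m S \<longleftrightarrow> stripe m S \<and> (\<exists>a b. fst ` S = {a..b})"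

definition inertia_stripe :: "nat \<Rightarrow> nat pair_pre_digraph \<Rightarrow> nat \<Rightarrow> (nat \<times> nat) set" where
  "inertia_stripe n G m = pin ` {A \<in> graph_matrices n G. vec_space.rank n A = m}"

definition inertia_convex_on_stripes :: "nat \<Rightarrow> nat pair_pre_digraph \<Rightarrow> bool" where
  "inertia_convex_on_stripes n G \<longleftrightarrow>
     (\<forall>m. min_rank n G \<le> m \<and> m \<le> n \<longrightarrow> convex_stripe m (inertia_stripe n G m))"

end

theory Submission
  imports Defs
begin

text \<open>
  Let \<open>A\<close> be a symmetric matrix of rank \<open>m\<close> with the graph \<open>G\<close>. Its inertia is a pair \<open>(r, s)\<close>
  with \<open>r + s = m\<close>, and \<open>- A\<close> realizes \<open>(s, r)\<close>. A set of such pairs that is symmetric in this way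
  is convex as soon as it contains \<open>(r - 1, s + 1)\<close> together with each \<open>(r, s)\<close> for which \<open>r > s\<close>.
  For a forest this step can be made by hand (\<open>forest_flip_positive_square\<close>), using Gaussian
  elimination along leaves.

  Let \<open>v\<close> be a vertex with at most one neighbour \<open>u\<close>. If the diagonal entry \<open>a\<close> of \<open>v\<close> is nonzero,
  then the quadratic form of \<open>A\<close> is the form of a Schur complement \<open>B\<close> plus a square with
  coefficient \<open>1 / a\<close>. Passing to \<open>B\<close> changes no entry outside the row and column of \<open>v\<close> except
  the diagonal entry of \<open>u\<close>, so \<open>B\<close> is a matrix of the forest without \<open>v\<close>. If the diagonal entry
  of \<open>v\<close> is zero and \<open>u\<close> exists, then \<open>u\<close> and \<open>v\<close> split off a hyperbolic plane, of inertia
  \<open>(1, 1)\<close>, and leave a matrix of the forest without \<open>u\<close> and \<open>v\<close>. When the positive inertia exceeds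
  the negative one, some square that is split off has a positive coefficient. Reversing the sign
  of that coefficient keeps the graph and the rank, and changes the inertia by \<open>(- 1, 1)\<close>.

  Two facts about inertia support this. By the spectral theorem, the numbers of positive and
  negative roots of the characteristic polynomial can be expressed by the quadratic form alone
  (\<open>pos_inertia_le_iff\<close>), and they add up to the rank (\<open>inertia_sum_eq_rank\<close>). From this it follows
  that adding a square \<open>c (l \<bullet> x)\<^sup>2\<close> to a form with a null vector \<open>z\<close> changes the inertia by exactly
  one, provided that \<open>l \<bullet> z \<noteq> 0\<close> (\<open>inertia_add_square\<close>, \<open>inertia_subtract_square\<close>). This covers both
  kinds of elimination step. It also shows that each rank from the minimum rank up to \<open>n\<close> occurs,
  since a suitable diagonal entry of a singular matrix can be increased; hence no stripe is empty.
\<close>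

section \<open>The spectral theorem for real symmetric matrices\<close>

lemma mult_mat_vec_sum:
  assumes "A \<in> carrier_mat n m" "x \<in> carrier_vec m" "i < n"
  shows "(A *\<^sub>v x) $ i = (\<Sum>j<m. A $$ (i,j) * x $ j)"
  using assms by (auto simp: scalar_prod_def atLeast0LessThan intro!: sum.cong)

lemma scalar_prod_sum:
  assumes "y \<in> carrier_vec n"
  shows "x \<bullet> y = (\<Sum>i<n. x $ i * y $ i)"
  using assms by (auto simp: scalar_prod_def atLeast0LessThan)

lemma symmetric_scalar_prod:
  fixes A :: "'a::comm_semiring_0 mat"
  assumes A: "A \<in> carrier_mat n n" "transpose_mat A = A"
    and x: "x \<in> carrier_vec n" and y: "y \<in> carrier_vec n"
  shows "x \<bullet> (A *\<^sub>v y) = (A *\<^sub>v x) \<bullet> y"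
  by (metis A x y transpose_vec_mult_scalar comm_scalar_prod mult_mat_vec_carrier)

text \<open>
  Over the complex numbers some \<open>c\<close> is an eigenvalue, with eigenvector \<open>x + i y\<close>. Symmetry gives
  \<open>x \<bullet> A y = A x \<bullet> y\<close>, and comparing the two sides forces \<open>Im c * (x \<bullet> x + y \<bullet> y) = 0\<close>.
  So \<open>c\<close> is real, and whichever of \<open>x\<close>, \<open>y\<close> is nonzero is a real eigenvector.
\<close>
lemma symmetric_real_eigenvalue:
  fixes A :: "real mat"
  assumes A: "A \<in> carrier_mat n n" and sym: "transpose_mat A = A" and n: "n > 0"
  obtains v e where "v \<in> carrier_vec n" "v \<bullet> v = 1" "A *\<^sub>v v = e \<cdot>\<^sub>v v"
proof -
  define C where "C = map_mat complex_of_real A"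
  have C: "C \<in> carrier_mat n n" using A by (simp add: C_def)
  obtain as where as: "char_poly C = (\<Prod>a\<leftarrow>as. [:- a, 1:])" "length as = n"
    using char_poly_factorized[OF C] by blast
  with n obtain c where "c \<in> set as" by (cases as) auto
  hence "poly (char_poly C) c = 0" unfolding as(1) by (induction as) auto
  then obtain w where w: "w \<in> carrier_vec n" "w \<noteq> 0\<^sub>v n" "C *\<^sub>v w = c \<cdot>\<^sub>v w"
    using C unfolding eigenvalue_root_char_poly[OF C, symmetric] eigenvalue_def eigenvector_def by auto
  define x where "x = map_vec Re w"
  define y where "y = map_vec Im w"
  have xy: "x \<in> carrier_vec n" "y \<in> carrier_vec n" using w by (auto simp: x_def y_def)
  have comp: "(\<Sum>j<n. complex_of_real (A $$ (i,j)) * w $ j) = c * w $ i" if "i < n" for i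
  proof -
    have "(\<Sum>j<n. C $$ (i,j) * w $ j) = c * w $ i"
      using w that by (subst mult_mat_vec_sum[OF C, symmetric]) auto
    moreover have "(\<Sum>j<n. C $$ (i,j) * w $ j) = (\<Sum>j<n. complex_of_real (A $$ (i,j)) * w $ j)"
      using A that by (intro sum.cong) (auto simp: C_def)
    ultimately show ?thesis by simp
  qed
  have Ax: "A *\<^sub>v x = Re c \<cdot>\<^sub>v x - Im c \<cdot>\<^sub>v y"
  proof (rule eq_vecI)
    fix i assume "i < dim_vec (Re c \<cdot>\<^sub>v x - Im c \<cdot>\<^sub>v y)"
    hence i: "i < n" using xy by simp
    show "(A *\<^sub>v x) $ i = (Re c \<cdot>\<^sub>v x - Im c \<cdot>\<^sub>v y) $ i"
      using arg_cong[OF comp[OF i], of Re] i xy w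
      by (subst mult_mat_vec_sum[OF A xy(1) i]) (simp add: x_def y_def)
  qed (use A xy in auto)
  have Ay: "A *\<^sub>v y = Im c \<cdot>\<^sub>v x + Re c \<cdot>\<^sub>v y"
  proof (rule eq_vecI)
    fix i assume "i < dim_vec (Im c \<cdot>\<^sub>v x + Re c \<cdot>\<^sub>v y)"
    hence i: "i < n" using xy by simp
    show "(A *\<^sub>v y) $ i = (Im c \<cdot>\<^sub>v x + Re c \<cdot>\<^sub>v y) $ i"
      using arg_cong[OF comp[OF i], of Im] i xy w
      by (subst mult_mat_vec_sum[OF A xy(2) i]) (simp add: x_def y_def algebra_simps)
  qed (use A xy in auto)
  have "x \<bullet> (A *\<^sub>v y) = (A *\<^sub>v x) \<bullet> y" by (rule symmetric_scalar_prod[OF A sym xy])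
  hence "Im c * (x \<bullet> x) + Re c * (x \<bullet> y) = Re c * (x \<bullet> y) - Im c * (y \<bullet> y)"
    unfolding Ax Ay using xy
    by (simp add: scalar_prod_add_distrib[of _ n] minus_scalar_prod_distrib[of _ n])
  hence eq: "Im c * (x \<bullet> x + y \<bullet> y) = 0" by (simp add: algebra_simps)
  have nonneg: "z \<bullet> z \<ge> 0" for z :: "real vec" by (simp add: scalar_prod_def sum_nonneg)
  have nz: "z \<bullet> z > 0" if "z \<in> carrier_vec n" "z \<noteq> 0\<^sub>v n" for z :: "real vec"
  proof -
    obtain i where "i < n" "z $ i \<noteq> 0" using \<open>z \<noteq> 0\<^sub>v n\<close> \<open>z \<in> carrier_vec n\<close> by (metis carrier_vecD eq_vecI index_zero_vec)
    thus ?thesis using that by (auto simp: scalar_prod_def intro!: sum_pos2[of _ i])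
  qed
  have "x \<noteq> 0\<^sub>v n \<or> y \<noteq> 0\<^sub>v n"
  proof (rule ccontr)
    assume "\<not> ?thesis"
    hence "x $ i = 0 \<and> y $ i = 0" if "i < n" for i using that by auto
    hence "w $ i = 0" if "i < n" for i using that w by (auto simp: x_def y_def complex_eq_iff)
    hence "w = 0\<^sub>v n" using w by (intro eq_vecI) auto
    thus False using w by simp
  qed
  then obtain z where z: "z \<in> carrier_vec n" "z \<noteq> 0\<^sub>v n" and zxy: "z = x \<or> z = y" using xy by blast
  have "x \<bullet> x + y \<bullet> y > 0" using nz[OF z] zxy nonneg[of x] nonneg[of y] by auto
  hence im: "Im c = 0" using eq by auto
  have Az: "A *\<^sub>v z = Re c \<cdot>\<^sub>v z" using zxy Ax Ay xy im by (auto intro!: eq_vecI)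
  show thesis
  proof (rule that[of "(1 / sqrt (z \<bullet> z)) \<cdot>\<^sub>v z" "Re c"])
    show "((1 / sqrt (z \<bullet> z)) \<cdot>\<^sub>v z) \<bullet> ((1 / sqrt (z \<bullet> z)) \<cdot>\<^sub>v z) = 1"
      using nz[OF z] z by (simp add: field_simps)
    show "A *\<^sub>v ((1 / sqrt (z \<bullet> z)) \<cdot>\<^sub>v z) = Re c \<cdot>\<^sub>v ((1 / sqrt (z \<bullet> z)) \<cdot>\<^sub>v z)"
      using Az z A by (simp add: mult_mat_vec[OF A] smult_smult_assoc mult.commute)
  qed (use z in auto)
qed

text \<open>
  The reflection in the hyperplane orthogonal to \<open>v - e\<^sub>0\<close> exchanges the unit vectors \<open>e\<^sub>0\<close> and
  \<open>v\<close>. It makes an eigenvector the first basis vector by an orthogonal change of basis.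
\<close>
lemma householder_reflection:
  fixes v :: "real vec"
  assumes v: "v \<in> carrier_vec n" and unit: "v \<bullet> v = 1" and n: "n > 0"
  obtains H where "H \<in> carrier_mat n n" "transpose_mat H = H" "H * H = 1\<^sub>m n"
    "H *\<^sub>v unit_vec n 0 = v"
proof (cases "v = unit_vec n 0")
  case True
  thus thesis using v by (intro that[of "1\<^sub>m n"]) auto
next
  case False
  define w where "w = v - unit_vec n 0"
  define s where "s = w \<bullet> w"
  have w: "w \<in> carrier_vec n" using v by (simp add: w_def)
  have "s = 2 - 2 * v $ 0"
    unfolding s_def w_def using v unit n
    by (simp add: scalar_prod_minus_distrib[of _ n] minus_scalar_prod_distrib[of _ n])
  moreover have w0: "w $ 0 = v $ 0 - 1" using v n by (simp add: w_def)
  ultimately have ws: "w $ 0 = - s / 2" by simp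
  have s: "s = (\<Sum>i<n. w $ i * w $ i)" unfolding s_def by (rule scalar_prod_sum[OF w])
  have s0: "s \<noteq> 0"
  proof
    assume "s = 0"
    hence "w $ i = 0" if "i < n" for i
      using that unfolding s by (subst (asm) sum_nonneg_eq_0_iff) auto
    hence "v $ i = unit_vec n 0 $ i" if "i < n" for i using that v by (auto simp: w_def)
    hence "v = unit_vec n 0" using v by (intro eq_vecI) auto
    thus False using False by simp
  qed
  define H where "H = mat n n (\<lambda>(i,j). (if i = j then 1 else 0) - 2 * w $ i * w $ j / s)"
  have H: "H \<in> carrier_mat n n" by (simp add: H_def)
  show thesis
  proof (rule that[OF H])
    show "transpose_mat H = H" unfolding H_def by (auto simp: transpose_mat_def intro!: eq_matI)
    show "H * H = 1\<^sub>m n"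
    proof (rule eq_matI)
      fix i j assume "i < dim_row (1\<^sub>m n)" "j < dim_col (1\<^sub>m n)"
      hence ij: "i < n" "j < n" by auto
      have "(H * H) $$ (i,j) = (\<Sum>k<n. H $$ (i,k) * H $$ (k,j))"
        using H ij by (auto simp: scalar_prod_def atLeast0LessThan)
      also have "\<dots> = (\<Sum>k<n. (if i = k then if k = j then 1 else 0 else 0)
          - (if k = i then 2 * w $ k * w $ j / s else 0)
          - (if k = j then 2 * w $ i * w $ k / s else 0)
          + 4 * w $ i * w $ j / (s * s) * (w $ k * w $ k))"
        using ij by (intro sum.cong) (auto simp: H_def algebra_simps)
      also have "\<dots> = (if i = j then 1 else 0) - 2 * w $ i * w $ j / s - 2 * w $ i * w $ j / s
         + 4 * w $ i * w $ j / (s * s) * s"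
        unfolding sum.distrib sum_subtractf sum_distrib_left[symmetric] s[symmetric]
        using ij by (simp add: sum.delta sum.delta')
      also have "\<dots> = 1\<^sub>m n $$ (i,j)" using ij s0 by simp
      finally show "(H * H) $$ (i,j) = 1\<^sub>m n $$ (i,j)" .
    qed (use H in auto)
    show "H *\<^sub>v unit_vec n 0 = v"
    proof (rule eq_vecI)
      fix i assume "i < dim_vec v"
      hence i: "i < n" using v by simp
      have "(H *\<^sub>v unit_vec n 0) $ i = H $$ (i,0)" using H i n by simp
      also have "\<dots> = (if i = 0 then 1 else 0) + w $ i"
        using i n ws s0 by (simp add: H_def)
      also have "\<dots> = v $ i" using i n v by (simp add: w_def)
      finally show "(H *\<^sub>v unit_vec n 0) $ i = v $ i" .
    qed (use H v in auto)
  qed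
qed

text \<open>
  After a reflection that moves a unit eigenvector to the first basis vector, the first column
  of the symmetric matrix is a multiple of that basis vector, and by symmetry so is the first row.
  What remains is a symmetric block of size one less.
\<close>
lemma spectral_theorem:
  fixes A :: "real mat"
  assumes "A \<in> carrier_mat n n" "transpose_mat A = A"
  shows "\<exists>Q d. Q \<in> carrier_mat n n \<and> transpose_mat Q * Q = 1\<^sub>m n
           \<and> A = transpose_mat Q * mat_diag n d * Q"
  using assms
proof (induction n arbitrary: A)
  case 0
  thus ?case by (intro exI[of _ "1\<^sub>m 0"] exI[of _ "\<lambda>_. 0"]) auto
next
  case (Suc n)
  let ?N = "Suc n"
  note A = Suc.prems(1) and sym = Suc.prems(2)
  obtain v e where v: "v \<in> carrier_vec ?N" "v \<bullet> v = 1" and Av: "A *\<^sub>v v = e \<cdot>\<^sub>v v"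
    using symmetric_real_eigenvalue[OF A sym] by blast
  obtain H where H: "H \<in> carrier_mat ?N ?N" "transpose_mat H = H" "H * H = 1\<^sub>m ?N"
    and Hv: "H *\<^sub>v unit_vec ?N 0 = v"
    using householder_reflection[OF v] by blast
  define M where "M = H * A * H"
  have M: "M \<in> carrier_mat ?N ?N" using H A by (simp add: M_def)
  have Msym: "transpose_mat M = M"
    unfolding M_def using H A sym
    by (simp add: transpose_mult[of _ ?N ?N _ ?N] assoc_mult_mat[of _ ?N ?N _ ?N _ ?N])
  have "M *\<^sub>v unit_vec ?N 0 = H *\<^sub>v (A *\<^sub>v (H *\<^sub>v unit_vec ?N 0))"
    unfolding M_def using H A by (simp add: assoc_mult_mat_vec[of _ ?N ?N _ ?N])
  also have "\<dots> = e \<cdot>\<^sub>v (H *\<^sub>v v)" unfolding Hv Av using H v by (simp add: mult_mat_vec)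
  also have "H *\<^sub>v v = unit_vec ?N 0"
    unfolding Hv[symmetric] using H by (simp add: assoc_mult_mat_vec[symmetric, of _ ?N ?N _ ?N])
  finally have "M *\<^sub>v unit_vec ?N 0 = e \<cdot>\<^sub>v unit_vec ?N 0" .
  hence col: "M $$ (i,0) = (if i = 0 then e else 0)" if "i < ?N" for i
  proof -
    have "(M *\<^sub>v unit_vec ?N 0) $ i = (e \<cdot>\<^sub>v unit_vec ?N 0) $ i"
      using \<open>M *\<^sub>v unit_vec ?N 0 = e \<cdot>\<^sub>v unit_vec ?N 0\<close> by simp
    thus ?thesis using that M by simp
  qed
  have row: "M $$ (0,i) = (if i = 0 then e else 0)" if "i < ?N" for i
  proof -
    have "M $$ (0,i) = transpose_mat M $$ (i,0)" using that M by simp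
    thus ?thesis using col[OF that] Msym by simp
  qed
  define B where "B = mat n n (\<lambda>(i,j). M $$ (Suc i, Suc j))"
  have B: "B \<in> carrier_mat n n" by (simp add: B_def)
  have "transpose_mat B = B"
  proof (rule eq_matI)
    fix i j assume "i < dim_row B" "j < dim_col B"
    thus "transpose_mat B $$ (i,j) = B $$ (i,j)"
      using arg_cong[OF Msym, of "\<lambda>X. X $$ (Suc i, Suc j)"] M by (simp add: B_def)
  qed (auto simp: B_def)
  from Suc.IH[OF B this] obtain Q d where Q: "Q \<in> carrier_mat n n" "transpose_mat Q * Q = 1\<^sub>m n"
    and BQ: "B = transpose_mat Q * mat_diag n d * Q" by blast
  define R where "R = four_block_mat (1\<^sub>m 1) (0\<^sub>m 1 n) (0\<^sub>m n 1) Q"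
  have R: "R \<in> carrier_mat ?N ?N" unfolding R_def using Q by auto
  have Rt: "transpose_mat R = four_block_mat (1\<^sub>m 1) (0\<^sub>m 1 n) (0\<^sub>m n 1) (transpose_mat Q)"
    unfolding R_def using Q by (subst transpose_four_block_mat) auto
  define f where "f = (\<lambda>i. case i of 0 \<Rightarrow> e | Suc k \<Rightarrow> d k)"
  have D: "mat_diag ?N f = four_block_mat (mat 1 1 (\<lambda>_. e)) (0\<^sub>m 1 n) (0\<^sub>m n 1) (mat_diag n d)"
    by (rule eq_matI) (auto simp: mat_diag_def f_def split: nat.splits)
  have RR: "transpose_mat R * R = 1\<^sub>m ?N"
    unfolding Rt unfolding R_def
    by (subst mult_four_block_mat[of _ 1 1 _ n _ n _ _ 1 _ n])
      (use Q in \<open>auto intro!: eq_matI\<close>)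
  have z: "0\<^sub>m (Suc 0) n * X = 0\<^sub>m (Suc 0) n" "X * 0\<^sub>m n (Suc 0) = 0\<^sub>m n (Suc 0)"
    if "X \<in> carrier_mat n n" for X :: "real mat"
    using that by auto
  have QDQ: "0\<^sub>m n n + transpose_mat Q * mat_diag n d * Q = transpose_mat Q * mat_diag n d * Q"
    by (rule left_add_zero_mat) (use Q in \<open>auto intro!: mult_carrier_mat[of _ _ n]\<close>)
  have "transpose_mat R * mat_diag ?N f * R
      = four_block_mat (mat 1 1 (\<lambda>_. e)) (0\<^sub>m 1 n) (0\<^sub>m n 1) B"
    unfolding Rt D unfolding R_def BQ using Q
    by (subst mult_four_block_mat[of _ 1 1 _ n _ n _ _ 1 _ n]; simp add: z)
       (subst mult_four_block_mat[of _ 1 1 _ n _ n _ _ 1 _ n]; simp add: z QDQ)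
  also have "\<dots> = M"
    by (rule eq_matI) (use M col row in \<open>auto simp: B_def\<close>)
  finally have MR: "M = transpose_mat R * mat_diag ?N f * R" by simp
  have AH: "A = H * M * H"
  proof -
    have "H * M * H = H * (H * (A * (H * H)))" unfolding M_def using H A
      by (simp add: assoc_mult_mat[of _ ?N ?N _ ?N _ ?N])
    also have "\<dots> = (H * H) * A" using H A
      by (simp add: assoc_mult_mat[symmetric, of _ ?N ?N _ ?N _ ?N])
    finally show ?thesis using H A by simp
  qed
  show ?case
  proof (intro exI conjI)
    show "R * H \<in> carrier_mat ?N ?N" using R H by simp
    have t: "transpose_mat (R * H) = H * transpose_mat R"
      using R H by (simp add: transpose_mult[of _ ?N ?N _ ?N])
    have Rt': "transpose_mat R \<in> carrier_mat ?N ?N" using R by simp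
    have DR: "mat_diag ?N f * R \<in> carrier_mat ?N ?N"
      by (rule mult_carrier_mat[OF mat_diag_dim R])
    hence RDR: "transpose_mat R * (mat_diag ?N f * R) \<in> carrier_mat ?N ?N"
      by (rule mult_carrier_mat[OF Rt'])
    have "transpose_mat (R * H) * (R * H) = H * ((transpose_mat R * R) * H)"
      unfolding t using R Rt' H by (simp add: assoc_mult_mat[of _ ?N ?N _ ?N _ ?N])
    thus "transpose_mat (R * H) * (R * H) = 1\<^sub>m ?N" using H unfolding RR by simp
    show "A = transpose_mat (R * H) * mat_diag ?N f * (R * H)"
      unfolding t AH MR using R Rt' DR RDR H by (simp add: assoc_mult_mat[of _ ?N ?N _ ?N _ ?N])
  qed
qed

section \<open>Inertia and rank from a diagonalization\<close>

lemma order_prod_linear_factors: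
  fixes x :: "'a::idom"
  shows "Polynomial.order x (\<Prod>a\<leftarrow>as. [:- a, 1:]) = count_list as x"
proof (induction as)
  case Nil
  show ?case by (simp add: order_0I)
next
  case (Cons a as)
  have nz: "(\<Prod>a\<leftarrow>b # as. [:- a, 1:]) \<noteq> 0" for b :: 'a
    by (subst prod_list_zero_iff) auto
  have "Polynomial.order x [:- a, 1:] = (if a = x then 1 else 0)"
    using order_power_n_n[of x 1] by (auto intro: order_0I)
  moreover have "Polynomial.order x (\<Prod>a\<leftarrow>a # as. [:- a, 1:])
      = Polynomial.order x [:- a, 1:] + Polynomial.order x (\<Prod>a\<leftarrow>as. [:- a, 1:])"
    using order_mult[of "[:- a, 1:]" "\<Prod>a\<leftarrow>as. [:- a, 1:]" x] nz[of a] by simp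
  ultimately show ?case using Cons by simp
qed

text \<open>
  With \<open>P\<close> the predicate of being positive (or negative) the left-hand side is the positive
  (or negative) inertia. An orthogonal congruence is also a similarity, so the eigenvalues of
  \<open>A\<close> with their multiplicities are the entries of \<open>d\<close>.
\<close>
lemma orthogonal_inertia_count:
  fixes A :: "real mat"
  assumes Q: "Q \<in> carrier_mat n n" "transpose_mat Q * Q = 1\<^sub>m n"
    and A: "A = transpose_mat Q * mat_diag n d * Q"
  shows "(\<Sum>x | eigenvalue A x \<and> P x. Polynomial.order x (char_poly A)) = card {i. i < n \<and> P (d i)}"
proof -
  have Ac: "A \<in> carrier_mat n n"
    unfolding A using Q by (auto intro!: mult_carrier_mat[of _ _ n])
  have Q': "Q * transpose_mat Q = 1\<^sub>m n"
    using mat_mult_left_right_inverse[of "transpose_mat Q" n Q] Q by simp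
  have "similar_mat A (mat_diag n d)"
    by (rule similar_matI[of _ _ "transpose_mat Q" Q n]) (use Q Q' Ac A in auto)
  hence "char_poly A = char_poly (mat_diag n d)" by (rule char_poly_similar)
  also have "\<dots> = (\<Prod>a\<leftarrow>diag_mat (mat_diag n d). [:- a, 1:])"
    by (rule char_poly_upper_triangular[of _ n]) (auto simp: mat_diag_def)
  also have "diag_mat (mat_diag n d) = map d [0..<n]"
    by (auto simp: diag_mat_def mat_diag_def)
  finally have cp: "char_poly A = (\<Prod>a\<leftarrow>map d [0..<n]. [:- a, 1:])" .
  have ord: "Polynomial.order x (char_poly A) = card {i. i < n \<and> d i = x}" for x
    unfolding cp order_prod_linear_factors count_list_eq_length_filter
    by (auto simp: filter_map o_def length_filter_conv_card intro!: arg_cong[of _ _ card])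
  have ev: "eigenvalue A x \<longleftrightarrow> x \<in> d ` {..<n}" for x
    unfolding eigenvalue_root_char_poly[OF Ac] cp
    by (simp add: poly_prod_list prod_list_zero_iff) auto
  have "{x. eigenvalue A x \<and> P x} = d ` {i. i < n \<and> P (d i)}"
    using ev by auto
  hence "(\<Sum>x | eigenvalue A x \<and> P x. Polynomial.order x (char_poly A))
      = (\<Sum>x\<in>d ` {i. i < n \<and> P (d i)}. card {i \<in> {i. i < n \<and> P (d i)}. d i = x})"
    by (intro sum.cong) (auto simp: ord intro!: arg_cong[of _ _ card])
  also have "\<dots> = card {i. i < n \<and> P (d i)}"
    using sum.image_gen[of "{i. i < n \<and> P (d i)}" "\<lambda>_. 1::nat" d] by simp
  finally show ?thesis .
qed

lemma congruence_diag_eq_mat: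
  fixes Q :: "'a::comm_semiring_1 mat"
  assumes "Q \<in> carrier_mat n n"
  shows "transpose_mat Q * mat_diag n d * Q = mat n n (\<lambda>(i,j). \<Sum>k<n. d k * Q $$ (k,i) * Q $$ (k,j))"
  using assms
  by (subst mat_diag_mult_right[of _ n])
     (auto simp: scalar_prod_def atLeast0LessThan mult_ac intro!: eq_matI sum.cong)

lemma rank_sum_of_products_le:
  fixes f g :: "'b \<Rightarrow> nat \<Rightarrow> 'a::field"
  assumes "finite S"
  shows "vec_space.rank n (mat n n (\<lambda>(i,j). \<Sum>k\<in>S. f k i * g k j)) \<le> card S"
  using assms
proof (induction S)
  case empty
  have "mat n n (\<lambda>(i,j). \<Sum>k\<in>{}. f k i * g k j) = 0\<^sub>m n n" by (intro eq_matI) auto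
  thus ?case by (simp only: vec_space.rank_0I card.empty)
next
  case (insert a S)
  let ?A = "mat n n (\<lambda>(i,j). \<Sum>k\<in>S. f k i * g k j)" and ?B = "mat n n (\<lambda>(i,j). f a i * g a j)"
  have "mat n n (\<lambda>(i,j). \<Sum>k\<in>insert a S. f k i * g k j) = ?B + ?A"
    using insert by (intro eq_matI) auto
  moreover have "vec_space.rank n (?B + ?A) \<le> vec_space.rank n ?B + vec_space.rank n ?A"
    by (rule vec_space.rank_subadditive) auto
  moreover have "vec_space.rank n ?B \<le> 1"
    by (rule vec_space.rank_le_1_product_entries[where f = "f a" and g = "g a"]) auto
  ultimately show ?case using insert by simp
qed

text \<open>
  Such a matrix is a sum of one matrix of rank at most one for each nonzero \<open>d k\<close>, which bounds
  the rank from above. Replacing every zero \<open>d k\<close> by \<open>1\<close> adds a matrix whose rank is at most the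
  number of zeros and produces an invertible matrix, which bounds it from below.
\<close>
lemma orthogonal_rank:
  fixes A :: "real mat"
  assumes Q: "Q \<in> carrier_mat n n" "transpose_mat Q * Q = 1\<^sub>m n"
    and A: "A = transpose_mat Q * mat_diag n d * Q"
  shows "vec_space.rank n A = card {i. i < n \<and> d i \<noteq> 0}"
proof (rule antisym)
  have Qt: "transpose_mat Q \<in> carrier_mat n n" using Q by simp
  let ?A = "\<lambda>d. transpose_mat Q * mat_diag n d * Q"
  have le: "vec_space.rank n (?A d) \<le> card {i. i < n \<and> d i \<noteq> 0}" for d
  proof -
    have "?A d = mat n n (\<lambda>(i,j). \<Sum>k\<in>{i. i < n \<and> d i \<noteq> 0}. (d k * Q $$ (k,i)) * Q $$ (k,j))"
      unfolding congruence_diag_eq_mat[OF Q(1)]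
      by (intro eq_matI) (auto intro!: sum.mono_neutral_right)
    thus ?thesis using rank_sum_of_products_le[of "{i. i < n \<and> d i \<noteq> 0}" n "\<lambda>k i. d k * Q $$ (k,i)"]
      by simp
  qed
  show "vec_space.rank n A \<le> card {i. i < n \<and> d i \<noteq> 0}" unfolding A by (rule le)
  \<comment> \<open>The complementary eigenvalues, which fill the null space of \<open>A\<close>.\<close>
  define d' where "d' = (\<lambda>k. if d k = 0 then 1 else 0 :: real)"
  have det: "det (?A (\<lambda>k. d k + d' k)) \<noteq> 0"
  proof -
    have "det (transpose_mat Q) * det Q = 1"
      using det_mult[of "transpose_mat Q" n Q] Q by simp
    moreover have "det (mat_diag n (\<lambda>k. d k + d' k)) = (\<Prod>a\<leftarrow>diag_mat (mat_diag n (\<lambda>k. d k + d' k)). a)"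
      by (subst det_upper_triangular[of _ n]) (auto simp: mat_diag_def)
    moreover have "0 \<notin> set (diag_mat (mat_diag n (\<lambda>k. d k + d' k)))"
      by (auto simp: diag_mat_def mat_diag_def d'_def split: if_splits)
    ultimately have "det (transpose_mat Q) * det Q = 1" "det (mat_diag n (\<lambda>k. d k + d' k)) \<noteq> 0"
      by (simp_all add: prod_list_zero_iff)
    moreover have "det (?A (\<lambda>k. d k + d' k))
        = det (transpose_mat Q) * det (mat_diag n (\<lambda>k. d k + d' k)) * det Q"
      using det_mult[OF mult_carrier_mat[OF Qt mat_diag_dim] Q(1)]
        det_mult[OF Qt mat_diag_dim] by simp
    ultimately show ?thesis by auto
  qed
  have "?A (\<lambda>k. d k + d' k) = ?A d + ?A d'"
    unfolding congruence_diag_eq_mat[OF Q(1)]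
    by (intro eq_matI) (auto simp: sum.distrib distrib_right)
  moreover have carr: "?A d \<in> carrier_mat n n" for d
    using Q by (simp add: congruence_diag_eq_mat)
  ultimately have "n \<le> vec_space.rank n (?A d) + vec_space.rank n (?A d')"
    using vec_space.det_rank_iff[of "?A (\<lambda>k. d k + d' k)" n] det
      vec_space.rank_subadditive[OF carr[of d] carr[of d']] by simp
  moreover have "card {i. i < n \<and> d i \<noteq> 0} + card {i. i < n \<and> d' i \<noteq> 0} = n"
  proof -
    have "card ({i. i < n \<and> d i \<noteq> 0} \<union> {i. i < n \<and> d' i \<noteq> 0})
        = card {i. i < n \<and> d i \<noteq> 0} + card {i. i < n \<and> d' i \<noteq> 0}"
      by (rule card_Un_disjoint) (auto simp: d'_def)
    moreover have "{i. i < n \<and> d i \<noteq> 0} \<union> {i. i < n \<and> d' i \<noteq> 0} = {..<n}"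
      by (auto simp: d'_def)
    ultimately show ?thesis by simp
  qed
  ultimately show "card {i. i < n \<and> d i \<noteq> 0} \<le> vec_space.rank n A"
    using le[of d'] unfolding A by linarith
qed

lemma inertia_uminus:
  assumes "A \<in> carrier_mat n n" "transpose_mat A = A"
  shows "pos_inertia (- A) = neg_inertia A" "neg_inertia (- A) = pos_inertia A"
    "vec_space.rank n (- A) = vec_space.rank n A"
proof -
  obtain Q d where Q: "Q \<in> carrier_mat n n" "transpose_mat Q * Q = 1\<^sub>m n"
    and A: "A = transpose_mat Q * mat_diag n d * Q"
    using spectral_theorem[OF assms] by blast
  have A': "- A = transpose_mat Q * mat_diag n (\<lambda>i. - d i) * Q"
    unfolding A congruence_diag_eq_mat[OF Q(1)] by (intro eq_matI) (auto simp: sum_negf)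
  note c = orthogonal_inertia_count[OF Q A] orthogonal_inertia_count[OF Q A']
  show "pos_inertia (- A) = neg_inertia A" "neg_inertia (- A) = pos_inertia A"
    unfolding pos_inertia_def neg_inertia_def c by simp_all
  show "vec_space.rank n (- A) = vec_space.rank n A"
    unfolding orthogonal_rank[OF Q A] orthogonal_rank[OF Q A'] by simp
qed

lemma inertia_sum_eq_rank:
  assumes "A \<in> carrier_mat n n" "transpose_mat A = A"
  shows "pos_inertia A + neg_inertia A = vec_space.rank n A"
proof -
  obtain Q d where Q: "Q \<in> carrier_mat n n" "transpose_mat Q * Q = 1\<^sub>m n"
    and A: "A = transpose_mat Q * mat_diag n d * Q"
    using spectral_theorem[OF assms] by blast
  have "{i. i < n \<and> d i \<noteq> 0} = {i. i < n \<and> d i > 0} \<union> {i. i < n \<and> d i < 0}" by auto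
  also have "card \<dots> = card {i. i < n \<and> d i > 0} + card {i. i < n \<and> d i < 0}"
    by (rule card_Un_disjoint) auto
  finally show ?thesis
    unfolding pos_inertia_def neg_inertia_def orthogonal_inertia_count[OF Q A] orthogonal_rank[OF Q A]
    by simp
qed

section \<open>Inertia as a codimension\<close>

text \<open>
  The functionals, padded with zero rows, form a singular square matrix.
\<close>
lemma common_zero_of_few_functionals:
  fixes fs :: "'a::field vec list"
  assumes fs: "set fs \<subseteq> carrier_vec n" and len: "length fs < n"
  obtains x where "x \<in> carrier_vec n" "x \<noteq> 0\<^sub>v n" "\<And>f. f \<in> set fs \<Longrightarrow> f \<bullet> x = 0"
proof -
  define c where "c = (\<lambda>i. if i < length fs then fs ! i else 0\<^sub>v n)"
  have c: "c i \<in> carrier_vec n" for i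
    using fs by (auto simp: c_def intro!: subsetD[OF fs])
  define M where "M = mat\<^sub>r n n (\<lambda>i. if i = length fs then 0\<^sub>v n else c i)"
  have M: "M \<in> carrier_mat n n" by (simp add: M_def)
  have "det M = 0"
    unfolding M_def using len c by (intro det_row_0) auto
  then obtain x where x: "x \<in> carrier_vec n" "x \<noteq> 0\<^sub>v n" "M *\<^sub>v x = 0\<^sub>v n"
    using det_0_iff_vec_prod_zero_field[OF M] by blast
  have "f \<bullet> x = 0" if "f \<in> set fs" for f
  proof -
    obtain i where i: "i < length fs" "f = fs ! i" using \<open>f \<in> set fs\<close> by (metis in_set_conv_nth)
    have "row M i = f" unfolding M_def using i len c[of i]
      by (subst row_mat_of_row_fun) (auto simp: c_def)
    moreover have "(M *\<^sub>v x) $ i = 0" using x i len by simp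
    ultimately show ?thesis using M i len by simp
  qed
  thus thesis using that x by blast
qed

lemma congruence_diag_form:
  fixes Q :: "real mat"
  assumes Q: "Q \<in> carrier_mat n n" and x: "x \<in> carrier_vec n"
    and A: "A = transpose_mat Q * mat_diag n d * Q"
  shows "x \<bullet> (A *\<^sub>v x) = (\<Sum>k<n. d k * ((Q *\<^sub>v x) $ k)\<^sup>2)"
proof -
  let ?y = "Q *\<^sub>v x"
  have y: "?y \<in> carrier_vec n" by (rule mult_mat_vec_carrier[OF Q x])
  have "A *\<^sub>v x = transpose_mat Q *\<^sub>v (mat_diag n d *\<^sub>v ?y)"
    unfolding A using Q x by (simp add: assoc_mult_mat_vec[of _ n n _ n])
  moreover have "x \<bullet> (transpose_mat Q *\<^sub>v (mat_diag n d *\<^sub>v ?y)) = ?y \<bullet> (mat_diag n d *\<^sub>v ?y)"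
    using transpose_vec_mult_scalar[of Q n n x "mat_diag n d *\<^sub>v ?y"] Q x
    by (metis comm_scalar_prod mat_diag_dim mult_mat_vec_carrier transpose_carrier_mat y)
  moreover have "(mat_diag n d *\<^sub>v ?y) $ k = d k * ?y $ k" if "k < n" for k
    unfolding mult_mat_vec_sum[OF mat_diag_dim y that]
    using that by (simp add: mat_diag_def sum.delta if_distrib[of "\<lambda>x. x * _"] cong: if_cong)
  hence "?y \<bullet> (mat_diag n d *\<^sub>v ?y) = (\<Sum>k<n. d k * (?y $ k)\<^sup>2)"
    using mult_mat_vec_carrier[OF mat_diag_dim y, of d]
    by (subst scalar_prod_sum[of _ n])
      (auto simp: power2_eq_square simp del: index_mult_mat_vec intro!: sum.cong)
  ultimately show ?thesis by simp
qed

text \<open>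
  The form of Sylvester's law of inertia that is used below: the positive inertia is the least
  number of linear conditions under which the quadratic form is nowhere positive. The rows of
  \<open>Q\<close> that belong to positive eigenvalues are such conditions. If fewer sufficed, then together
  with the rows for the other eigenvalues there would be fewer than \<open>n\<close> conditions, and a common
  nonzero zero of them would have a positive value.
\<close>
lemma pos_inertia_le_iff:
  assumes Ac: "A \<in> carrier_mat n n" "transpose_mat A = A"
  shows "pos_inertia A \<le> p \<longleftrightarrow>
    (\<exists>fs. set fs \<subseteq> carrier_vec n \<and> length fs \<le> p \<and>
      (\<forall>x\<in>carrier_vec n. (\<forall>f\<in>set fs. f \<bullet> x = 0) \<longrightarrow> x \<bullet> (A *\<^sub>v x) \<le> 0))" (is "_ \<longleftrightarrow> ?R")
proof -
  obtain Q d where Q: "Q \<in> carrier_mat n n" "transpose_mat Q * Q = 1\<^sub>m n"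
    and A: "A = transpose_mat Q * mat_diag n d * Q"
    using spectral_theorem[OF Ac] by blast
  have pos: "pos_inertia A = card {i. i < n \<and> d i > 0}"
    unfolding pos_inertia_def by (rule orthogonal_inertia_count[OF Q A])
  note form = congruence_diag_form[OF Q(1) _ A]
  have row: "row Q k \<bullet> x = (Q *\<^sub>v x) $ k" if "k < n" for k x
    using Q that by simp
  define ks where "ks = (\<lambda>P. filter P [0..<n])"
  have len: "length (ks P) = card {i. i < n \<and> P i}" for P
    by (auto simp: ks_def length_filter_conv_card intro!: arg_cong[of _ _ card])
  show ?thesis
  proof
    assume le: "pos_inertia A \<le> p"
    show ?R
    proof (intro exI[of _ "map (row Q) (ks (\<lambda>i. d i > 0))"] conjI ballI impI)
      fix x assume x: "x \<in> carrier_vec n"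
        and z: "\<forall>f\<in>set (map (row Q) (ks (\<lambda>i. d i > 0))). f \<bullet> x = 0"
      have "d k * ((Q *\<^sub>v x) $ k)\<^sup>2 \<le> 0" if "k < n" for k
      proof (cases "d k > 0")
        case True
        hence "(Q *\<^sub>v x) $ k = 0" using z that by (auto simp: ks_def row[symmetric])
        thus ?thesis by simp
      qed (simp add: mult_nonpos_nonneg)
      thus "x \<bullet> (A *\<^sub>v x) \<le> 0" unfolding form[OF x] by (intro sum_nonpos) auto
    qed (use le pos len Q in auto)
  next
    assume ?R
    then obtain fs where fs: "set fs \<subseteq> carrier_vec n" "length fs \<le> p"
      and neg: "\<And>x. x \<in> carrier_vec n \<Longrightarrow> (\<And>f. f \<in> set fs \<Longrightarrow> f \<bullet> x = 0) \<Longrightarrow> x \<bullet> (A *\<^sub>v x) \<le> 0"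
      by blast
    show "pos_inertia A \<le> p"
    proof (rule ccontr)
      assume "\<not> ?thesis"
      hence gt: "card {i. i < n \<and> d i > 0} > p" using pos by simp
      have "card ({i. i < n \<and> d i > 0} \<union> {i. i < n \<and> \<not> d i > 0})
          = card {i. i < n \<and> d i > 0} + card {i. i < n \<and> \<not> d i > 0}"
        by (rule card_Un_disjoint) auto
      moreover have "{i. i < n \<and> d i > 0} \<union> {i. i < n \<and> \<not> d i > 0} = {..<n}" by auto
      ultimately have "length (fs @ map (row Q) (ks (\<lambda>i. \<not> d i > 0))) < n"
        using len fs gt by simp
      moreover have "set (fs @ map (row Q) (ks (\<lambda>i. \<not> d i > 0))) \<subseteq> carrier_vec n" using fs Q by auto
      ultimately obtain x where x: "x \<in> carrier_vec n" "x \<noteq> 0\<^sub>v n"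
        and z: "\<And>f. f \<in> set (fs @ map (row Q) (ks (\<lambda>i. \<not> d i > 0))) \<Longrightarrow> f \<bullet> x = 0"
        using common_zero_of_few_functionals by blast
      have x0: "(Q *\<^sub>v x) $ k = 0" if "k < n" "\<not> d k > 0" for k
        using z[of "row Q k"] that by (auto simp: ks_def row)
      have "Q *\<^sub>v x \<noteq> 0\<^sub>v n"
      proof
        assume "Q *\<^sub>v x = 0\<^sub>v n"
        hence "transpose_mat Q *\<^sub>v (Q *\<^sub>v x) = 0\<^sub>v n" using Q by auto
        hence "(transpose_mat Q * Q) *\<^sub>v x = 0\<^sub>v n"
          using Q(1) x by (subst assoc_mult_mat_vec[of _ n n _ n]) auto
        thus False using x unfolding Q(2) by simp
      qed
      then obtain k where k: "k < n" "(Q *\<^sub>v x) $ k \<noteq> 0"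
        by (metis Q(1) carrier_matD(1) dim_mult_mat_vec eq_vecI index_zero_vec)
      hence dk: "d k > 0" using x0 by blast
      have "x \<bullet> (A *\<^sub>v x) > 0"
        unfolding form[OF x(1)]
      proof (rule sum_pos2[of _ k])
        fix i assume i: "i \<in> {..<n}"
        show "0 \<le> d i * ((Q *\<^sub>v x) $ i)\<^sup>2" using x0[of i] i by (cases "d i > 0") (auto simp del: index_mult_mat_vec)
      qed (use k dk in \<open>auto simp del: index_mult_mat_vec\<close>)
      thus False using neg[of x] z x by auto
    qed
  qed
qed

section \<open>Adding squares and hyperbolic planes\<close>

lemma symmetric_mat_iff:
  assumes "A \<in> carrier_mat n n"
  shows "transpose_mat A = A \<longleftrightarrow> (\<forall>i<n. \<forall>j<n. A $$ (j,i) = A $$ (i,j))"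
proof
  assume sym: "transpose_mat A = A"
  show "\<forall>i<n. \<forall>j<n. A $$ (j,i) = A $$ (i,j)"
  proof (intro allI impI)
    fix i j assume "i < n" "j < n"
    hence "A $$ (j,i) = transpose_mat A $$ (i,j)" using assms by simp
    thus "A $$ (j,i) = A $$ (i,j)" unfolding sym .
  qed
qed (use assms in \<open>auto intro!: eq_matI\<close>)

lemma neg_inertia_le_iff:
  assumes A: "A \<in> carrier_mat n n" "transpose_mat A = A"
  shows "neg_inertia A \<le> p \<longleftrightarrow>
    (\<exists>fs. set fs \<subseteq> carrier_vec n \<and> length fs \<le> p \<and>
      (\<forall>x\<in>carrier_vec n. (\<forall>f\<in>set fs. f \<bullet> x = 0) \<longrightarrow> 0 \<le> x \<bullet> (A *\<^sub>v x)))"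
proof -
  have sym: "transpose_mat (- A) = - A" using A(2) by (simp add: transpose_uminus)
  have "x \<bullet> (- A *\<^sub>v x) = - (x \<bullet> (A *\<^sub>v x))" if "x \<in> carrier_vec n" for x
    using A that by simp
  thus ?thesis
    using pos_inertia_le_iff[OF uminus_carrier_mat[OF A(1)] sym, of p] inertia_uminus(1)[OF A]
    by simp
qed

lemma rank_one_update_mult_vec:
  fixes A B :: "real mat"
  assumes A: "A \<in> carrier_mat n n" and B: "B \<in> carrier_mat n n"
    and l: "l \<in> carrier_vec n" and x: "x \<in> carrier_vec n"
    and eq: "\<And>i j. i < n \<Longrightarrow> j < n \<Longrightarrow> A $$ (i,j) = B $$ (i,j) + c * l $ i * l $ j"
  shows "A *\<^sub>v x = B *\<^sub>v x + (c * (l \<bullet> x)) \<cdot>\<^sub>v l"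
proof (rule eq_vecI)
  fix i assume "i < dim_vec (B *\<^sub>v x + (c * (l \<bullet> x)) \<cdot>\<^sub>v l)"
  hence i: "i < n" using l by simp
  have "(\<Sum>j<n. A $$ (i,j) * x $ j) = (\<Sum>j<n. B $$ (i,j) * x $ j) + c * (\<Sum>j<n. l $ j * x $ j) * l $ i"
    using i by (simp add: eq algebra_simps sum.distrib sum_distrib_left sum_distrib_right)
  thus "(A *\<^sub>v x) $ i = (B *\<^sub>v x + (c * (l \<bullet> x)) \<cdot>\<^sub>v l) $ i"
    using i l B x mult_mat_vec_sum[OF A x i] mult_mat_vec_sum[OF B x i] scalar_prod_sum[OF x, of l]
    by (simp del: index_mult_mat_vec)
qed (use A l in auto)

text \<open>
  Since \<open>l \<bullet> z \<noteq> 0\<close>, every \<open>x\<close> can be moved along the null vector \<open>z\<close> of \<open>B\<close> onto the hyperplane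
  \<open>l \<bullet> x = 0\<close>, where the two quadratic forms agree, without changing the value of the form of
  \<open>B\<close>. Thus the added square is independent of the form of \<open>B\<close> and contributes exactly one
  positive eigenvalue. In terms of the conditions that determine the inertia: adjoining \<open>l\<close> turns
  conditions for \<open>B\<close> into conditions for \<open>A\<close>; conversely one of the conditions \<open>f\<close> for \<open>A\<close> must
  be nonzero at \<open>z\<close>, and eliminating it by moves along \<open>z\<close> leaves one condition fewer for \<open>B\<close>.
\<close>
lemma inertia_add_square:
  fixes A B :: "real mat"
  assumes A: "A \<in> carrier_mat n n" and B: "B \<in> carrier_mat n n" "transpose_mat B = B"
    and l: "l \<in> carrier_vec n" and z: "z \<in> carrier_vec n"
    and eq: "\<And>i j. i < n \<Longrightarrow> j < n \<Longrightarrow> A $$ (i,j) = B $$ (i,j) + c * l $ i * l $ j"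
    and null: "B *\<^sub>v z = 0\<^sub>v n" and lz: "l \<bullet> z \<noteq> 0" and c: "c > 0"
  shows "pos_inertia A = Suc (pos_inertia B)" "neg_inertia A = neg_inertia B"
proof -
  have sym: "transpose_mat A = A"
    using B(2) unfolding symmetric_mat_iff[OF B(1)] symmetric_mat_iff[OF A] by (simp add: eq)
  define qA where "qA = (\<lambda>x. x \<bullet> (A *\<^sub>v x))"
  define qB where "qB = (\<lambda>x. x \<bullet> (B *\<^sub>v x))"
  have qA_fold: "x \<bullet> (A *\<^sub>v x) = qA x" for x by (simp add: qA_def)
  have qA: "qA x = qB x + c * (l \<bullet> x)\<^sup>2" if x: "x \<in> carrier_vec n" for x
    using rank_one_update_mult_vec[OF A B(1) l x eq] x l B mult_mat_vec_carrier[OF B(1) x]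
    by (simp add: qA_def qB_def scalar_prod_add_distrib[of _ n] power2_eq_square comm_scalar_prod[of x n l])
  have shift: "qB (x - t \<cdot>\<^sub>v z) = qB x" if x: "x \<in> carrier_vec n" for x t
  proof -
    have Bx: "B *\<^sub>v x \<in> carrier_vec n" by (rule mult_mat_vec_carrier[OF B(1) x])
    have "B *\<^sub>v (x - t \<cdot>\<^sub>v z) = B *\<^sub>v x - t \<cdot>\<^sub>v (B *\<^sub>v z)"
      using B x z by (simp add: mult_minus_distrib_mat_vec[of _ n n] mult_mat_vec[of _ n n])
    also have "\<dots> = B *\<^sub>v x" unfolding null using Bx B by (intro eq_vecI) auto
    finally have 1: "B *\<^sub>v (x - t \<cdot>\<^sub>v z) = B *\<^sub>v x" .
    have "z \<bullet> (B *\<^sub>v x) = 0"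
      using symmetric_scalar_prod[OF B z x] x by (simp add: null)
    thus ?thesis unfolding qB_def 1 using x z Bx
      by (simp add: minus_scalar_prod_distrib[of _ n])
  qed
  have sprod: "g \<bullet> (x - t \<cdot>\<^sub>v z) = g \<bullet> x - t * (g \<bullet> z)"
    if "g \<in> carrier_vec n" "x \<in> carrier_vec n" for g x t
    using that z by (simp add: scalar_prod_minus_distrib[of _ n])
  have sprod': "(g - t \<cdot>\<^sub>v f) \<bullet> x = g \<bullet> x - t * (f \<bullet> x)"
    if "g \<in> carrier_vec n" "f \<in> carrier_vec n" "x \<in> carrier_vec n" for g f x :: "real vec" and t
    using that by (simp add: minus_scalar_prod_distrib[of _ n])
  have "pos_inertia A \<le> Suc (pos_inertia B)"
  proof -
    obtain fs where fs: "set fs \<subseteq> carrier_vec n" "length fs \<le> pos_inertia B"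
      and neg: "\<And>x. x \<in> carrier_vec n \<Longrightarrow> (\<And>f. f \<in> set fs \<Longrightarrow> f \<bullet> x = 0) \<Longrightarrow> qB x \<le> 0"
      using pos_inertia_le_iff[OF B, of "pos_inertia B"] unfolding qB_def by auto
    show ?thesis
      unfolding pos_inertia_le_iff[OF A sym]
      by (rule exI[of _ "l # fs"]) (use fs neg l qA in \<open>auto simp: qA_fold\<close>)
  qed
  moreover have "Suc (pos_inertia B) \<le> pos_inertia A"
  proof -
    obtain fs where fs: "set fs \<subseteq> carrier_vec n" "length fs \<le> pos_inertia A"
      and neg: "\<And>x. x \<in> carrier_vec n \<Longrightarrow> (\<And>f. f \<in> set fs \<Longrightarrow> f \<bullet> x = 0) \<Longrightarrow> qA x \<le> 0"
      using pos_inertia_le_iff[OF A sym, of "pos_inertia A"] unfolding qA_def by auto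
    have "qB z = 0" unfolding qB_def null using z by simp
    hence "qA z > 0" using qA[OF z] c lz by simp
    then obtain f where f: "f \<in> set fs" "f \<bullet> z \<noteq> 0" using neg[OF z] by force
    have fc: "f \<in> carrier_vec n" using f fs by auto
    \<comment> \<open>The value at \<open>x\<close> of each new functional is the value of \<open>g\<close> at the zero of
      \<open>f\<close> on the line through \<open>x\<close> along \<open>z\<close>.\<close>
    define gs where "gs = map (\<lambda>g. g - ((g \<bullet> z) / (f \<bullet> z)) \<cdot>\<^sub>v f) (remove1 f fs)"
    have "length fs > 0" using f by auto
    hence "pos_inertia A > 0" using fs by linarith
    have "length gs \<le> pos_inertia A - 1"
      using fs f by (auto simp: gs_def length_remove1)
    moreover have "qB x \<le> 0"
      if x: "x \<in> carrier_vec n" and van: "\<And>g. g \<in> set gs \<Longrightarrow> g \<bullet> x = 0" for x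
    proof -
      define y where "y = x - ((f \<bullet> x) / (f \<bullet> z)) \<cdot>\<^sub>v z"
      have y: "y \<in> carrier_vec n" using x z by (simp add: y_def)
      have "g \<bullet> y = 0" if g: "g \<in> set fs" for g
      proof (cases "g = f")
        case True
        thus ?thesis unfolding y_def using sprod[OF fc x] f by simp
      next
        case False
        hence "g - ((g \<bullet> z) / (f \<bullet> z)) \<cdot>\<^sub>v f \<in> set gs" using g by (auto simp: gs_def)
        hence "(g - ((g \<bullet> z) / (f \<bullet> z)) \<cdot>\<^sub>v f) \<bullet> x = 0" by (rule van)
        moreover have "g \<in> carrier_vec n" using g fs by auto
        ultimately show ?thesis unfolding y_def
          by (simp add: sprod[OF _ x] sprod'[OF _ fc x] mult.commute)
      qed
      hence "qA y \<le> 0" using neg y by blast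
      moreover have "c * (l \<bullet> y)\<^sup>2 \<ge> 0" using c by simp
      ultimately have "qB y \<le> 0" using qA[OF y] by linarith
      thus ?thesis using shift[OF x] by (simp add: y_def)
    qed
    moreover have "set gs \<subseteq> carrier_vec n"
      using fs fc set_remove1_subset[of f fs] by (auto simp: gs_def)
    ultimately have "pos_inertia B \<le> pos_inertia A - 1"
      unfolding pos_inertia_le_iff[OF B] qB_def by blast
    thus ?thesis using \<open>pos_inertia A > 0\<close> by simp
  qed
  ultimately show "pos_inertia A = Suc (pos_inertia B)" by simp
  have "neg_inertia A \<le> neg_inertia B"
  proof -
    obtain fs where fs: "set fs \<subseteq> carrier_vec n" "length fs \<le> neg_inertia B"
      and pos: "\<And>x. x \<in> carrier_vec n \<Longrightarrow> (\<And>f. f \<in> set fs \<Longrightarrow> f \<bullet> x = 0) \<Longrightarrow> qB x \<ge> 0"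
      using neg_inertia_le_iff[OF B, of "neg_inertia B"] unfolding qB_def by auto
    show ?thesis
      unfolding neg_inertia_le_iff[OF A sym]
      by (rule exI[of _ fs]) (use fs pos qA c in \<open>auto simp: qA_fold\<close>)
  qed
  moreover have "neg_inertia B \<le> neg_inertia A"
  proof -
    obtain fs where fs: "set fs \<subseteq> carrier_vec n" "length fs \<le> neg_inertia A"
      and pos: "\<And>x. x \<in> carrier_vec n \<Longrightarrow> (\<And>f. f \<in> set fs \<Longrightarrow> f \<bullet> x = 0) \<Longrightarrow> qA x \<ge> 0"
      using neg_inertia_le_iff[OF A sym, of "neg_inertia A"] unfolding qA_def by auto
    \<comment> \<open>The same substitution along \<open>z\<close>, now onto the hyperplane
      \<open>l \<bullet> x = 0\<close>; no condition is lost.\<close>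
    define gs where "gs = map (\<lambda>g. g - ((g \<bullet> z) / (l \<bullet> z)) \<cdot>\<^sub>v l) fs"
    have "qB x \<ge> 0"
      if x: "x \<in> carrier_vec n" and van: "\<And>g. g \<in> set gs \<Longrightarrow> g \<bullet> x = 0" for x
    proof -
      define y where "y = x - ((l \<bullet> x) / (l \<bullet> z)) \<cdot>\<^sub>v z"
      have y: "y \<in> carrier_vec n" using x z by (simp add: y_def)
      have "g \<bullet> y = 0" if g: "g \<in> set fs" for g
      proof -
        have "(g - ((g \<bullet> z) / (l \<bullet> z)) \<cdot>\<^sub>v l) \<bullet> x = 0"
          using g by (intro van) (auto simp: gs_def)
        moreover have "g \<in> carrier_vec n" using g fs by auto
        ultimately show ?thesis unfolding y_def
          by (simp add: sprod[OF _ x] sprod'[OF _ l x] mult.commute)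
      qed
      hence "qA y \<ge> 0" using pos y by blast
      moreover have "l \<bullet> y = 0" unfolding y_def using sprod[OF l x] lz by simp
      ultimately have "qB y \<ge> 0" using qA[OF y] by simp
      thus ?thesis using shift[OF x] by (simp add: y_def)
    qed
    moreover have "set gs \<subseteq> carrier_vec n" "length gs \<le> neg_inertia A"
      using fs l by (auto simp: gs_def)
    ultimately show ?thesis
      unfolding neg_inertia_le_iff[OF B] qB_def by blast
  qed
  ultimately show "neg_inertia A = neg_inertia B" by simp
qed

lemma inertia_subtract_square:
  fixes A B :: "real mat"
  assumes A: "A \<in> carrier_mat n n" and B: "B \<in> carrier_mat n n" "transpose_mat B = B"
    and l: "l \<in> carrier_vec n" and z: "z \<in> carrier_vec n"
    and eq: "\<And>i j. i < n \<Longrightarrow> j < n \<Longrightarrow> A $$ (i,j) = B $$ (i,j) + c * l $ i * l $ j"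
    and null: "B *\<^sub>v z = 0\<^sub>v n" and lz: "l \<bullet> z \<noteq> 0" and c: "c < 0"
  shows "pos_inertia A = pos_inertia B" "neg_inertia A = Suc (neg_inertia B)"
proof -
  have sym: "transpose_mat A = A"
    using B(2) unfolding symmetric_mat_iff[OF B(1)] symmetric_mat_iff[OF A] by (simp add: eq)
  have "pos_inertia (- A) = Suc (pos_inertia (- B))" "neg_inertia (- A) = neg_inertia (- B)"
    by (rule inertia_add_square[of _ n _ l z "- c"]; use assms in \<open>simp add: transpose_uminus\<close>)+
  thus "pos_inertia A = pos_inertia B" "neg_inertia A = Suc (neg_inertia B)"
    using inertia_uminus[OF A sym] inertia_uminus[OF B] by simp_all
qed

text \<open>
  The added form \<open>2 (e \<bullet> x) (m \<bullet> x)\<close> equals half the square of \<open>(e + m) \<bullet> x\<close> minus half the square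
  of \<open>(e - m) \<bullet> x\<close>. After the first square has been added, a combination \<open>y\<close> of \<open>z\<close> and \<open>w\<close> is
  still a null vector and permits the second one to be subtracted.
\<close>
lemma inertia_add_hyperbolic_plane:
  fixes A B :: "real mat"
  assumes A: "A \<in> carrier_mat n n" and B: "B \<in> carrier_mat n n" "transpose_mat B = B"
    and e: "e \<in> carrier_vec n" and m: "m \<in> carrier_vec n"
    and z: "z \<in> carrier_vec n" and w: "w \<in> carrier_vec n"
    and eq: "\<And>i j. i < n \<Longrightarrow> j < n \<Longrightarrow> A $$ (i,j) = B $$ (i,j) + e $ i * m $ j + m $ i * e $ j"
    and null: "B *\<^sub>v z = 0\<^sub>v n" "B *\<^sub>v w = 0\<^sub>v n"
    and ew: "e \<bullet> w = 0" and mw: "m \<bullet> w \<noteq> 0" and ez: "e \<bullet> z \<noteq> 0"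
  shows "pos_inertia A = Suc (pos_inertia B)" "neg_inertia A = Suc (neg_inertia B)"
proof -
  have em: "e + m \<in> carrier_vec n" "e - m \<in> carrier_vec n" using e m by auto
  define C where "C = mat n n (\<lambda>(i,j). B $$ (i,j) + (1/2) * (e + m) $ i * (e + m) $ j)"
  have C: "C \<in> carrier_mat n n" by (simp add: C_def)
  have CB: "C $$ (i,j) = B $$ (i,j) + (1/2) * (e + m) $ i * (e + m) $ j" if "i < n" "j < n" for i j
    using that by (simp add: C_def)
  have Csym: "transpose_mat C = C"
    using B(2) unfolding symmetric_mat_iff[OF B(1)] symmetric_mat_iff[OF C] by (simp add: CB)
  have AC: "A $$ (i,j) = C $$ (i,j) + (- 1/2) * (e - m) $ i * (e - m) $ j" if "i < n" "j < n" for i j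
    using that e m by (simp add: eq CB field_simps)
  \<comment> \<open>The coefficient for which \<open>e + m\<close> vanishes at \<open>z + t \<cdot>\<^sub>v w\<close>.\<close>
  define t where "t = - (e \<bullet> z + m \<bullet> z) / (m \<bullet> w)"
  define y where "y = z + t \<cdot>\<^sub>v w"
  have y: "y \<in> carrier_vec n" using z w by (simp add: y_def)
  have ey: "e \<bullet> y = e \<bullet> z" unfolding y_def using e z w ew
    by (simp add: scalar_prod_add_distrib[of _ n])
  have my: "m \<bullet> y = - (e \<bullet> z)" unfolding y_def using m z w mw
    by (simp add: scalar_prod_add_distrib[of _ n] t_def)
  have "B *\<^sub>v y = 0\<^sub>v n" unfolding y_def using B z w null
    by (auto simp: mult_add_distrib_mat_vec[of _ n n] mult_mat_vec[of _ n n] intro!: eq_vecI)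
  moreover have "(e + m) \<bullet> y = 0" using e m y ey my by (simp add: add_scalar_prod_distrib[of _ n])
  ultimately have Cy: "C *\<^sub>v y = 0\<^sub>v n"
    using rank_one_update_mult_vec[OF C B(1) em(1) y CB] e m by (simp, intro eq_vecI) auto
  have emw: "(e + m) \<bullet> w \<noteq> 0" using e m w ew mw by (simp add: add_scalar_prod_distrib[of _ n])
  have emy: "(e - m) \<bullet> y \<noteq> 0" using e m y ey my ez by (simp add: minus_scalar_prod_distrib[of _ n])
  note 1 = inertia_add_square[OF C B em(1) w CB null(2) emw]
  note 2 = inertia_subtract_square[OF A C Csym em(2) y AC Cy emy]
  show "pos_inertia A = Suc (pos_inertia B)" "neg_inertia A = Suc (neg_inertia B)"
    using 1 2 by simp_all
qed

section \<open>Leaves of forests\<close>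

lemma pair_graph_finite_sym_irrefl:
  assumes "pair_graph G"
  shows "finite (pverts G)" "sym (parcs G)" "(v, v) \<notin> parcs G"
  using pair_fin_digraph.pair_finite_verts pair_sym_digraph.pair_sym_arcs
    pair_loopfree_digraph.pair_no_loops[of G "(v, v)"] assms
  by (auto simp: pair_graph_def pair_digraph_def pair_pseudo_graph_def symmetric_def)

lemma successively_imp_awalk:
  assumes "successively (\<lambda>a b. (a, b) \<in> E) xs" "xs \<noteq> []"
  shows "pcas (hd xs) (zip xs (tl xs)) (last xs) \<and> pawalk_verts (hd xs) (zip xs (tl xs)) = xs
    \<and> set (zip xs (tl xs)) \<subseteq> E"
  using assms
  by (induction "\<lambda>a b. (a, b) \<in> E" xs rule: successively.induct) auto

text \<open>
  The closed walk runs through \<open>xs\<close> and back to its head, so its number of arcs is the length of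
  \<open>xs\<close>, not one less.
\<close>
lemma cycle_of_successively:
  assumes succ: "successively (\<lambda>a b. (a, b) \<in> parcs G) xs"
    and xs: "distinct xs" "xs \<noteq> []" "set xs \<subseteq> pverts G"
    and closing: "(last xs, hd xs) \<in> parcs G"
  shows "\<exists>p. pre_digraph.cycle (with_proj G) p \<and> length p = length xs"
proof -
  define ys where "ys = xs @ [hd xs]"
  define p where "p = zip ys (tl ys)"
  have ys: "ys \<noteq> []" "hd ys = hd xs" "last ys = hd xs" using xs by (auto simp: ys_def)
  have "successively (\<lambda>a b. (a, b) \<in> parcs G) ys"
    using succ closing xs by (simp add: ys_def successively_append_iff)
  from successively_imp_awalk[OF this ys(1)]
  have p: "pcas (hd xs) p (hd xs)" "pawalk_verts (hd xs) p = ys" "set p \<subseteq> parcs G"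
    unfolding ys p_def by auto
  have len: "length p = length xs" using xs by (simp add: p_def ys_def)
  have "distinct (tl ys)"
    using xs by (cases xs) (auto simp: ys_def)
  hence "pre_digraph.cycle (with_proj G) p"
    unfolding pre_digraph.cycle_def pre_digraph.awalk_def awalk_verts_with_proj_eq cas_with_proj_eq
    using p len xs by (intro exI[of _ "hd xs"]) auto
  thus ?thesis using len by blast
qed

text \<open>
  Otherwise every vertex of \<open>W\<close> has two neighbours in \<open>W\<close>. In a longest path inside \<open>W\<close> both
  neighbours of the head lie on the path, since otherwise it could be extended. One of them is not
  the second vertex, and the edge to it closes a cycle with at least three vertices.
\<close>
lemma forest_subset_has_leaf:
  fixes G :: "'a pair_pre_digraph"
  assumes G: "pair_graph G" and forest: "undirected_forest G"
    and W: "W \<subseteq> pverts G" "W \<noteq> {}"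
  shows "\<exists>v\<in>W. \<forall>a\<in>W. \<forall>b\<in>W. (v, a) \<in> parcs G \<longrightarrow> (v, b) \<in> parcs G \<longrightarrow> a = b"
proof (rule ccontr)
  assume no_leaf: "\<not> ?thesis"
  note fin = pair_graph_finite_sym_irrefl(1)[OF G]
    and symE = symD[OF pair_graph_finite_sym_irrefl(2)[OF G]]
    and loop = pair_graph_finite_sym_irrefl(3)[OF G]
  have finW: "finite W" using W(1) fin by (rule finite_subset)
  define paths where "paths = {xs. xs \<noteq> [] \<and> distinct xs \<and> set xs \<subseteq> W \<and>
    successively (\<lambda>a b. (a, b) \<in> parcs G) xs}"
  have "length xs \<le> card W" if "xs \<in> paths" for xs
    using that finW by (auto simp: paths_def distinct_card[symmetric] intro!: card_mono)
  moreover obtain w where "w \<in> W" using W(2) by blast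
  hence "[w] \<in> paths" by (simp add: paths_def)
  ultimately obtain xs where xs: "xs \<in> paths" and max: "\<And>ys. ys \<in> paths \<Longrightarrow> length ys \<le> length xs"
    using ex_has_greatest_nat[of "\<lambda>xs. xs \<in> paths" _ length "Suc (card W)"]
    by (metis le_imp_less_Suc)
  have xsp: "xs \<noteq> []" "distinct xs" "set xs \<subseteq> W" "successively (\<lambda>a b. (a, b) \<in> parcs G) xs"
    using xs by (auto simp: paths_def)
  have "hd xs \<in> W" using xsp by auto
  then obtain a b where ab: "a \<in> W" "b \<in> W" "(hd xs, a) \<in> parcs G" "(hd xs, b) \<in> parcs G" "a \<noteq> b"
    using no_leaf by blast
  have on_path: "c \<in> set xs" "c \<noteq> hd xs" if "c \<in> W" "(hd xs, c) \<in> parcs G" for c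
  proof -
    show "c \<in> set xs"
    proof (rule ccontr)
      assume "c \<notin> set xs"
      moreover have "(c, hd xs) \<in> parcs G" using that(2) by (rule symE)
      ultimately have "c # xs \<in> paths" using that xsp by (auto simp: paths_def successively_Cons)
      thus False using max by fastforce
    qed
    show "c \<noteq> hd xs" using that loop by metis
  qed
  have "\<exists>c. c \<in> W \<and> (hd xs, c) \<in> parcs G \<and> c \<noteq> xs ! 1" using ab by blast
  then obtain c where c: "c \<in> W" "(hd xs, c) \<in> parcs G" "c \<noteq> xs ! 1" by blast
  obtain k where k: "k < length xs" "xs ! k = c" using on_path(1)[OF c(1,2)] by (metis in_set_conv_nth)
  have "k \<noteq> 0" using on_path(2)[OF c(1,2)] k xsp(1) by (metis hd_conv_nth)
  moreover have "k \<noteq> 1" using c(3) k by blast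
  ultimately have k2: "k \<ge> 2" by simp
  define zs where "zs = take (Suc k) xs"
  have "successively (\<lambda>a b. (a, b) \<in> parcs G) (zs @ drop (Suc k) xs)"
    using xsp by (simp add: zs_def)
  hence "successively (\<lambda>a b. (a, b) \<in> parcs G) zs" by (simp add: successively_append_iff)
  moreover have "hd zs = hd xs" using xsp(1) by (cases xs) (auto simp: zs_def)
  moreover have "zs \<noteq> []" "length zs = Suc k" "last zs = c"
    using k xsp by (auto simp: zs_def take_Suc_conv_app_nth)
  moreover have "distinct zs" "set zs \<subseteq> pverts G"
    using xsp W(1) set_take_subset[of "Suc k" xs] by (auto simp: zs_def)
  moreover have "(c, hd xs) \<in> parcs G" using c(2) by (rule symE)
  ultimately obtain p where "pre_digraph.cycle (with_proj G) p" "length p = Suc k"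
    using cycle_of_successively[of G zs] by auto
  thus False using forest k2 by (auto simp: undirected_forest_def)
qed

section \<open>Elimination of leaves\<close>

text \<open>
  The matrices of the subgraph induced on \<open>W\<close>, padded with zero rows and columns to the fixed
  size \<open>n\<close>. The padding changes neither the positive nor the negative inertia, so that vertices
  can be deleted without a change of dimension.
\<close>
definition matrices_on :: "nat \<Rightarrow> (nat \<times> nat) set \<Rightarrow> nat set \<Rightarrow> real mat set" where
  "matrices_on n E W = {A \<in> carrier_mat n n. transpose_mat A = A \<and>
     (\<forall>i<n. \<forall>j<n. i \<noteq> j \<longrightarrow> (A $$ (i, j) \<noteq> 0 \<longleftrightarrow> (i, j) \<in> E \<and> i \<in> W \<and> j \<in> W)) \<and>
     (\<forall>i<n. i \<notin> W \<longrightarrow> A $$ (i, i) = 0)}"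

lemma graph_matrices_eq_matrices_on: "graph_matrices n G = matrices_on n (parcs G) {0..<n}"
  by (auto simp: graph_matrices_def matrices_on_def)

lemma matrices_onD:
  assumes "A \<in> matrices_on n E W"
  shows "A \<in> carrier_mat n n" "transpose_mat A = A"
    "i < n \<Longrightarrow> j < n \<Longrightarrow> A $$ (j, i) = A $$ (i, j)"
    "i < n \<Longrightarrow> j < n \<Longrightarrow> i \<noteq> j \<Longrightarrow> A $$ (i, j) \<noteq> 0 \<longleftrightarrow> (i, j) \<in> E \<and> i \<in> W \<and> j \<in> W"
    "i < n \<Longrightarrow> j < n \<Longrightarrow> i \<notin> W \<Longrightarrow> A $$ (i, j) = 0"
proof -
  show A: "A \<in> carrier_mat n n" "transpose_mat A = A" using assms by (auto simp: matrices_on_def)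
  show "i < n \<Longrightarrow> j < n \<Longrightarrow> A $$ (j, i) = A $$ (i, j)" using A symmetric_mat_iff by blast
  show nz: "i < n \<Longrightarrow> j < n \<Longrightarrow> i \<noteq> j \<Longrightarrow> A $$ (i, j) \<noteq> 0 \<longleftrightarrow> (i, j) \<in> E \<and> i \<in> W \<and> j \<in> W"
    using assms by (auto simp: matrices_on_def)
  show "i < n \<Longrightarrow> j < n \<Longrightarrow> i \<notin> W \<Longrightarrow> A $$ (i, j) = 0"
    using assms nz by (cases "i = j") (auto simp: matrices_on_def)
qed

lemma matrices_onI:
  assumes "A \<in> carrier_mat n n"
    and "\<And>i j. i < n \<Longrightarrow> j < n \<Longrightarrow> A $$ (j, i) = A $$ (i, j)"
    and "\<And>i j. i < n \<Longrightarrow> j < n \<Longrightarrow> i \<noteq> j \<Longrightarrow> A $$ (i, j) \<noteq> 0 \<longleftrightarrow> (i, j) \<in> E \<and> i \<in> W \<and> j \<in> W"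
    and "\<And>i. i < n \<Longrightarrow> i \<notin> W \<Longrightarrow> A $$ (i, i) = 0"
  shows "A \<in> matrices_on n E W"
  using assms symmetric_mat_iff[of A n] by (auto simp: matrices_on_def)

lemma matrices_on_mult_unit_vec:
  assumes A: "A \<in> matrices_on n E W" and v: "v < n" "v \<notin> W"
  shows "A *\<^sub>v unit_vec n v = 0\<^sub>v n"
proof (rule eq_vecI)
  fix i assume "i < dim_vec (0\<^sub>v n)"
  hence i: "i < n" by simp
  have "(A *\<^sub>v unit_vec n v) $ i = A $$ (i, v)" using i v matrices_onD(1)[OF A] by simp
  also have "\<dots> = 0" using matrices_onD(3)[OF A i v(1)] matrices_onD(5)[OF A v(1) i v(2)] by simp
  finally show "(A *\<^sub>v unit_vec n v) $ i = 0\<^sub>v n $ i" using i by simp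
qed (use matrices_onD(1)[OF A] in simp)

text \<open>
  Gaussian elimination at a vertex \<open>v\<close> with a nonzero diagonal entry, read backwards: \<open>B\<close> is the
  Schur complement and \<open>l\<close> a multiple of the row of \<open>v\<close>. As \<open>v\<close> has at most one neighbour, the
  square alters no off-diagonal entry of \<open>B\<close> outside the row and column of \<open>v\<close>, whatever the sign
  of \<open>c\<close>.
\<close>
lemma add_pendant_square:
  assumes B: "B \<in> matrices_on n E (W - {v})" and A: "A \<in> carrier_mat n n"
    and v: "v \<in> W" "v < n" and E: "sym E"
    and leaf: "\<forall>a\<in>W. \<forall>b\<in>W. (v, a) \<in> E \<longrightarrow> (v, b) \<in> E \<longrightarrow> a = b"
    and l: "l \<in> carrier_vec n" "l $ v \<noteq> 0"
      "\<forall>i<n. i \<noteq> v \<longrightarrow> (l $ i \<noteq> 0 \<longleftrightarrow> i \<in> W \<and> (v, i) \<in> E)"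
    and entries: "\<forall>i<n. \<forall>j<n. A $$ (i,j) = B $$ (i,j) + c * l $ i * l $ j"
    and c: "c \<noteq> 0"
  shows "A \<in> matrices_on n E W"
    and "c > 0 \<Longrightarrow> pos_inertia A = Suc (pos_inertia B) \<and> neg_inertia A = neg_inertia B"
    and "c < 0 \<Longrightarrow> pos_inertia A = pos_inertia B \<and> neg_inertia A = Suc (neg_inertia B)"
proof -
  note BD = matrices_onD[OF B] and eq = entries[rule_format]
  show "A \<in> matrices_on n E W"
  proof (rule matrices_onI[OF A])
    fix i j assume ij: "i < n" "j < n"
    show "A $$ (j,i) = A $$ (i,j)" using eq[OF ij] eq[OF ij(2,1)] BD(3)[OF ij] by simp
    assume ne: "i \<noteq> j"
    consider "i = v" | "j = v" | "i \<noteq> v" "j \<noteq> v" by blast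
    thus "A $$ (i,j) \<noteq> 0 \<longleftrightarrow> (i, j) \<in> E \<and> i \<in> W \<and> j \<in> W"
    proof cases
      case 1
      hence "B $$ (i,j) = 0" using BD(5)[OF ij] by simp
      thus ?thesis using eq[OF ij] l c v 1 ne ij by auto
    next
      case 2
      hence "B $$ (i,j) = 0" using BD(5)[OF ij(2,1)] BD(3)[OF ij] by simp
      thus ?thesis using eq[OF ij] l c v 2 ne ij E by (auto dest: symD)
    next
      case 3
      hence "l $ i * l $ j = 0" using l(3) leaf ij ne by (metis mult_eq_0_iff)
      hence "A $$ (i,j) = B $$ (i,j)" using eq[OF ij] by (simp add: mult.assoc)
      thus ?thesis using BD(4)[OF ij ne] 3 by simp
    qed
  next
    fix i assume i: "i < n" "i \<notin> W"
    hence "i \<noteq> v" using v by auto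
    hence "l $ i = 0" using l(3) i by blast
    thus "A $$ (i,i) = 0" using eq[OF i(1) i(1)] BD(5)[OF i(1) i(1)] i by simp
  qed
  have null: "B *\<^sub>v unit_vec n v = 0\<^sub>v n" using B v by (intro matrices_on_mult_unit_vec) auto
  have lv: "l \<bullet> unit_vec n v \<noteq> 0" using l v by simp
  show "c > 0 \<Longrightarrow> pos_inertia A = Suc (pos_inertia B) \<and> neg_inertia A = neg_inertia B"
    using inertia_add_square[OF A BD(1,2) l(1) _ eq null lv] by simp
  show "c < 0 \<Longrightarrow> pos_inertia A = pos_inertia B \<and> neg_inertia A = Suc (neg_inertia B)"
    using inertia_subtract_square[OF A BD(1,2) l(1) _ eq null lv] by simp
qed

text \<open>
  The case of a zero diagonal entry at \<open>v\<close>, whose only neighbour is \<open>u\<close>. The rows and columns of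
  \<open>u\<close> and \<open>v\<close> then form a hyperbolic plane: the coordinate of \<open>v\<close> occurs only in a product with
  the coordinate of \<open>u\<close>. The vector \<open>m\<close> is the row of \<open>u\<close> with its diagonal entry halved.
\<close>
lemma add_pendant_hyperbolic_plane:
  assumes B: "B \<in> matrices_on n E (W - {u, v})" and A: "A \<in> carrier_mat n n"
    and uv: "u \<in> W" "v \<in> W" "u < n" "v < n" "u \<noteq> v" "(v, u) \<in> E" and E: "sym E"
    and leaf: "\<forall>a\<in>W. (v, a) \<in> E \<longrightarrow> a = u"
    and m: "m \<in> carrier_vec n" "\<forall>i<n. i \<noteq> u \<longrightarrow> (m $ i \<noteq> 0 \<longleftrightarrow> i \<in> W \<and> (u, i) \<in> E)"
    and entries: "\<forall>i<n. \<forall>j<n.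
      A $$ (i,j) = B $$ (i,j) + unit_vec n u $ i * m $ j + m $ i * unit_vec n u $ j"
  shows "A \<in> matrices_on n E W"
    and "pos_inertia A = Suc (pos_inertia B)" and "neg_inertia A = Suc (neg_inertia B)"
proof -
  note BD = matrices_onD[OF B] and eq = entries[rule_format]
  show "A \<in> matrices_on n E W"
  proof (rule matrices_onI[OF A])
    fix i j assume ij: "i < n" "j < n"
    show "A $$ (j,i) = A $$ (i,j)" using eq[OF ij] eq[OF ij(2,1)] BD(3)[OF ij] by simp
    assume ne: "i \<noteq> j"
    consider "i = u" | "j = u" | "i \<noteq> u" "j \<noteq> u" by blast
    thus "A $$ (i,j) \<noteq> 0 \<longleftrightarrow> (i, j) \<in> E \<and> i \<in> W \<and> j \<in> W"
    proof cases
      case 1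
      hence "B $$ (i,j) = 0" using BD(5)[OF ij] by simp
      thus ?thesis using eq[OF ij] m uv 1 ne ij by auto
    next
      case 2
      hence "B $$ (i,j) = 0" using BD(5)[OF ij(2,1)] BD(3)[OF ij] by simp
      thus ?thesis using eq[OF ij] m uv 2 ne ij E by (auto dest: symD)
    next
      case 3
      hence "A $$ (i,j) = B $$ (i,j)" using eq[OF ij] ij uv by simp
      thus ?thesis using BD(4)[OF ij ne] 3 leaf E by (auto dest: symD)
    qed
  next
    fix i assume i: "i < n" "i \<notin> W"
    hence "i \<noteq> u" using uv by auto
    thus "A $$ (i,i) = 0" using eq[OF i(1) i(1)] BD(5)[OF i(1) i(1)] i uv by simp
  qed
  have null: "B *\<^sub>v unit_vec n u = 0\<^sub>v n" "B *\<^sub>v unit_vec n v = 0\<^sub>v n"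
    using B uv by (auto intro!: matrices_on_mult_unit_vec)
  have mv: "m \<bullet> unit_vec n v \<noteq> 0" using m uv E by (auto dest: symD)
  have eu: "unit_vec n u \<bullet> unit_vec n v = (0::real)" "unit_vec n u \<bullet> unit_vec n u \<noteq> (0::real)"
    using uv by auto
  note h = inertia_add_hyperbolic_plane[OF A BD(1,2) unit_vec_carrier m(1)
      unit_vec_carrier unit_vec_carrier eq null eu(1) mv eu(2)]
  show "pos_inertia A = Suc (pos_inertia B)" "neg_inertia A = Suc (neg_inertia B)"
    using h by simp_all
qed

text \<open>
  The vertices of \<open>W\<close> are eliminated one leaf after another. A vertex with nonzero diagonal entry
  splits off a square of the sign of that entry, an isolated vertex with zero diagonal entry
  splits off nothing, and a leaf with zero diagonal entry splits off a hyperbolic plane together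
  with its neighbour. Splitting off a negative square or a hyperbolic plane does not decrease the
  difference of the positive and the negative inertia of what remains, and for the empty graph
  this difference is zero. So a positive square must be split off at some stage. Reversing its
  sign and undoing the elimination steps
  before it gives a matrix with the same graph.
\<close>
lemma forest_flip_positive_square:
  assumes E: "sym E" "\<And>v. (v, v) \<notin> E"
    and forest: "\<And>U. U \<subseteq> {..<n} \<Longrightarrow> U \<noteq> {} \<Longrightarrow>
      \<exists>v\<in>U. \<forall>a\<in>U. \<forall>b\<in>U. (v, a) \<in> E \<longrightarrow> (v, b) \<in> E \<longrightarrow> a = b"
    and "W \<subseteq> {..<n}" "A \<in> matrices_on n E W" "neg_inertia A < pos_inertia A"
  shows "\<exists>A'\<in>matrices_on n E W. pos_inertia A = Suc (pos_inertia A') \<and>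
    neg_inertia A' = Suc (neg_inertia A)"
  using assms(4-6)
proof (induction "card W" arbitrary: W A rule: less_induct)
  case less
  note Wn = less.prems(1) and AW = less.prems(2) and gt = less.prems(3)
  note AD = matrices_onD[OF AW]
  have finW: "finite W" using Wn finite_subset by blast
  have "W \<noteq> {}"
  proof
    assume "W = {}"
    hence "A = 0\<^sub>m n n" using AD(1) AD(5) by (intro eq_matI) auto
    moreover have "0\<^sub>m n n *\<^sub>v x = 0\<^sub>v n" if "x \<in> carrier_vec n" for x :: "real vec"
      using that by (intro eq_vecI) auto
    ultimately have "pos_inertia A \<le> 0"
      unfolding pos_inertia_le_iff[OF AD(1,2)] by (intro exI[of _ "[]"]) auto
    thus False using gt by simp
  qed
  then obtain v where vW: "v \<in> W"
    and leaf: "\<forall>a\<in>W. \<forall>b\<in>W. (v, a) \<in> E \<longrightarrow> (v, b) \<in> E \<longrightarrow> a = b"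
    using forest[OF Wn] by blast
  have v: "v < n" using vW Wn by auto
  consider (pivot) "A $$ (v,v) \<noteq> 0"
    | (isolated) "A $$ (v,v) = 0" "\<And>u. u \<in> W \<Longrightarrow> (v, u) \<notin> E"
    | (pendant) u where "A $$ (v,v) = 0" "u \<in> W" "(v, u) \<in> E" by blast
  thus ?case
  proof cases
    case pivot
    define a where "a = A $$ (v,v)"
    define l where "l = vec n (\<lambda>i. A $$ (v,i))"
    define B where "B = mat n n (\<lambda>(i,j). A $$ (i,j) - (1/a) * l $ i * l $ j)"
    have a: "a \<noteq> 0" using pivot by (simp add: a_def)
    have l: "l \<in> carrier_vec n" "l $ v \<noteq> 0"
      "\<forall>i<n. i \<noteq> v \<longrightarrow> (l $ i \<noteq> 0 \<longleftrightarrow> i \<in> W \<and> (v, i) \<in> E)"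
      using a v vW AD(4)[OF v] by (auto simp: l_def a_def)
    have Bv: "B $$ (v,i) = 0" if "i < n" for i
      using that v a by (simp add: B_def l_def a_def[symmetric])
    have Bsym: "B $$ (j,i) = B $$ (i,j)" if "i < n" "j < n" for i j
      using that AD(3)[of i j] by (simp add: B_def)
    have B: "B \<in> matrices_on n E (W - {v})"
    proof (rule matrices_onI)
      show "B \<in> carrier_mat n n" by (simp add: B_def)
      fix i j assume ij: "i < n" "j < n" and ne: "i \<noteq> j"
      show "B $$ (i, j) \<noteq> 0 \<longleftrightarrow> (i, j) \<in> E \<and> i \<in> W - {v} \<and> j \<in> W - {v}"
      proof (cases "i = v \<or> j = v")
        case True
        hence "B $$ (i,j) = 0" using Bv Bsym ij by metis
        thus ?thesis using True by auto
      next
        case False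
        hence "l $ i * l $ j = 0" using l(3) leaf ij ne by (metis mult_eq_0_iff)
        hence "B $$ (i,j) = A $$ (i,j)" using ij by (simp add: B_def mult.assoc)
        thus ?thesis using AD(4)[OF ij ne] False by simp
      qed
    next
      fix i assume i: "i < n" "i \<notin> W - {v}"
      show "B $$ (i,i) = 0"
      proof (cases "i = v")
        case True
        thus ?thesis using Bv v by simp
      next
        case False
        hence "i \<notin> W" using i by simp
        moreover from this have "l $ i = 0" using l(3) i False by blast
        ultimately show ?thesis using AD(5)[OF i(1) i(1)] i by (simp add: B_def)
      qed
    qed (rule Bsym)
    note pend = add_pendant_square[OF _ _ vW v E(1) leaf l]
    have A: "pos_inertia A = Suc (pos_inertia B) \<and> neg_inertia A = neg_inertia B" if "a > 0"
      using that by (intro pend(2)[OF B AD(1), of "1/a"]) (auto simp: B_def)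
    have A2: "pos_inertia A = pos_inertia B \<and> neg_inertia A = Suc (neg_inertia B)" if "a < 0"
      using that by (intro pend(3)[OF B AD(1), of "1/a"]) (auto simp: B_def)
    show ?thesis
    proof (cases "a > 0")
      case True
      \<comment> \<open>The flip itself: the same Schur complement with the opposite pivot.\<close>
      define A' where "A' = mat n n (\<lambda>(i,j). B $$ (i,j) + (- 1/a) * l $ i * l $ j)"
      have A': "A' \<in> carrier_mat n n" "\<forall>i<n. \<forall>j<n.
          A' $$ (i,j) = B $$ (i,j) + (- 1/a) * l $ i * l $ j"
        by (auto simp: A'_def)
      have "A' \<in> matrices_on n E W" by (rule pend(1)[OF B A']) (use a in auto)
      moreover have "pos_inertia A' = pos_inertia B \<and> neg_inertia A' = Suc (neg_inertia B)"
        by (rule pend(3)[OF B A']) (use True in auto)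
      ultimately show ?thesis using A True by (intro bexI[of _ A']) auto
    next
      case False
      hence neg: "a < 0" using a by simp
      have "card (W - {v}) < card W" using vW finW by (intro psubset_card_mono) auto
      moreover have "neg_inertia B < pos_inertia B" using A2[OF neg] gt by simp
      ultimately obtain B' where B': "B' \<in> matrices_on n E (W - {v})"
        and inertia: "pos_inertia B = Suc (pos_inertia B')" "neg_inertia B' = Suc (neg_inertia B)"
        using less.hyps[of "W - {v}" B] B Wn by auto
      define A' where "A' = mat n n (\<lambda>(i,j). B' $$ (i,j) + (1/a) * l $ i * l $ j)"
      have A': "A' \<in> carrier_mat n n" "\<forall>i<n. \<forall>j<n.
          A' $$ (i,j) = B' $$ (i,j) + (1/a) * l $ i * l $ j"
        by (auto simp: A'_def)
      have "A' \<in> matrices_on n E W" by (rule pend(1)[OF B' A']) (use a in auto)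
      moreover have "pos_inertia A' = pos_inertia B' \<and> neg_inertia A' = Suc (neg_inertia B')"
        by (rule pend(3)[OF B' A']) (use neg in auto)
      ultimately show ?thesis using A2[OF neg] inertia by (intro bexI[of _ A']) auto
    qed
  next
    case isolated
    have eq: "X \<in> matrices_on n E (W - {v}) \<Longrightarrow> X \<in> matrices_on n E W" for X
      using isolated(2) E(1) vW by (auto simp: matrices_on_def dest: symD)
    have "A \<in> matrices_on n E (W - {v})"
      using AW isolated E(1) vW by (auto simp: matrices_on_def dest: symD)
    moreover have "card (W - {v}) < card W" using vW finW by (intro psubset_card_mono) auto
    ultimately show ?thesis using less.hyps[of "W - {v}" A] Wn gt eq by blast
  next
    case pendant
    have u: "u < n" using pendant Wn by auto
    have uv: "u \<noteq> v" using pendant E(2) by auto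
    have leaf': "\<forall>a\<in>W. (v, a) \<in> E \<longrightarrow> a = u" using leaf pendant by blast
    define m where "m = vec n (\<lambda>j. if j = u then A $$ (u,u) / 2 else A $$ (u,j))"
    define e :: "real vec" where "e = unit_vec n u"
    define B where "B = mat n n (\<lambda>(i,j). A $$ (i,j) - e $ i * m $ j - m $ i * e $ j)"
    have m: "m \<in> carrier_vec n" "\<forall>i<n. i \<noteq> u \<longrightarrow> (m $ i \<noteq> 0 \<longleftrightarrow> i \<in> W \<and> (u, i) \<in> E)"
      using AD(4)[OF u] pendant by (auto simp: m_def)
    have Bsym: "B $$ (j,i) = B $$ (i,j)" if "i < n" "j < n" for i j
      using that AD(3)[of i j] by (simp add: B_def)
    have Bu: "B $$ (u,i) = 0" if "i < n" for i
      using that u by (auto simp: B_def e_def m_def)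
    have BA: "B $$ (i,j) = A $$ (i,j)" if "i < n" "j < n" "i \<noteq> u" "j \<noteq> u" for i j
      using that u by (simp add: B_def e_def)
    have Bv: "B $$ (v,i) = 0" if i: "i < n" for i
    proof (cases "i = u \<or> i = v")
      case True
      thus ?thesis using Bu[OF v] Bsym[OF u v] BA[OF v v] uv pendant(1) by auto
    next
      case False
      thus ?thesis using BA[OF v i] uv AD(4)[OF v i] leaf' by auto
    qed
    have B: "B \<in> matrices_on n E (W - {u, v})"
    proof (rule matrices_onI)
      show "B \<in> carrier_mat n n" by (simp add: B_def)
      fix i j assume ij: "i < n" "j < n" and ne: "i \<noteq> j"
      show "B $$ (i, j) \<noteq> 0 \<longleftrightarrow> (i, j) \<in> E \<and> i \<in> W - {u, v} \<and> j \<in> W - {u, v}"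
      proof (cases "i \<in> {u, v} \<or> j \<in> {u, v}")
        case True
        hence "B $$ (i,j) = 0" using Bv Bu Bsym[OF ij] ij by auto
        thus ?thesis using True by auto
      next
        case False
        thus ?thesis using BA[OF ij] AD(4)[OF ij ne] by auto
      qed
    next
      fix i assume i: "i < n" "i \<notin> W - {u, v}"
      show "B $$ (i,i) = 0"
        using Bu Bv BA[OF i(1) i(1)] AD(5)[OF i(1) i(1)] i by (cases "i \<in> {u, v}") auto
    qed (rule Bsym)
    note pend = add_pendant_hyperbolic_plane[OF _ _ pendant(2) vW u v uv pendant(3) E(1) leaf' m,
        folded e_def]
    have A: "pos_inertia A = Suc (pos_inertia B)" "neg_inertia A = Suc (neg_inertia B)"
      by (rule pend[OF B AD(1)]; simp add: B_def)+
    have "card (W - {u, v}) < card W" using vW finW by (intro psubset_card_mono) auto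
    then obtain B' where B': "B' \<in> matrices_on n E (W - {u, v})"
      and inertia: "pos_inertia B = Suc (pos_inertia B')" "neg_inertia B' = Suc (neg_inertia B)"
      using less.hyps[of "W - {u, v}" B] B Wn A gt by auto
    define A' where "A' = mat n n (\<lambda>(i,j). B' $$ (i,j) + e $ i * m $ j + m $ i * e $ j)"
    have A': "A' \<in> carrier_mat n n" "\<forall>i<n. \<forall>j<n.
          A' $$ (i,j) = B' $$ (i,j) + e $ i * m $ j + m $ i * e $ j"
      by (auto simp: A'_def)
    have "A' \<in> matrices_on n E W" "pos_inertia A' = Suc (pos_inertia B')"
      "neg_inertia A' = Suc (neg_inertia B')"
      by (rule pend[OF B' A']; assumption)+
    thus ?thesis using A inertia by (intro bexI[of _ A']) auto
  qed
qed

section \<open>Ranks of the matrices of a graph\<close>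

lemma graph_matrices_uminus:
  assumes "A \<in> graph_matrices n G"
  shows "- A \<in> graph_matrices n G"
  using assms unfolding graph_matrices_def by (clarsimp simp: transpose_uminus)

text \<open>
  If \<open>A\<close> has a null vector whose coordinate \<open>k\<close> is nonzero, then increasing the diagonal entry
  \<open>k\<close> adds an independent square. Diagonal entries are unrestricted.
\<close>
lemma graph_matrices_Suc_rank:
  assumes A: "A \<in> graph_matrices n G" and rank: "vec_space.rank n A < n"
  shows "\<exists>A'\<in>graph_matrices n G. vec_space.rank n A' = Suc (vec_space.rank n A)"
proof -
  have Ac: "A \<in> carrier_mat n n" "transpose_mat A = A" using A by (auto simp: graph_matrices_def)
  have "det A = 0" using vec_space.det_rank_iff[OF Ac(1)] rank by auto
  then obtain z where z: "z \<in> carrier_vec n" "z \<noteq> 0\<^sub>v n" "A *\<^sub>v z = 0\<^sub>v n"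
    using det_0_iff_vec_prod_zero_field[OF Ac(1)] by blast
  then obtain k where k: "k < n" "z $ k \<noteq> 0" by (metis carrier_vecD eq_vecI index_zero_vec)
  define e :: "real vec" where "e = unit_vec n k"
  define A' where "A' = mat n n (\<lambda>(i,j). A $$ (i,j) + 1 * e $ i * e $ j)"
  have A': "A' \<in> carrier_mat n n" "\<And>i j. i < n \<Longrightarrow> j < n \<Longrightarrow> A' $$ (i,j) = A $$ (i,j) + 1 * e $ i * e $ j"
    by (auto simp: A'_def)
  have sym: "transpose_mat A' = A'"
    using Ac unfolding symmetric_mat_iff[OF Ac(1)] symmetric_mat_iff[OF A'(1)] by (simp add: A')
  have "A' \<in> graph_matrices n G"
    using A k A' sym by (auto simp: graph_matrices_def e_def)
  moreover have "e \<bullet> z \<noteq> 0" using k z by (simp add: e_def)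
  hence "pos_inertia A' = Suc (pos_inertia A)" "neg_inertia A' = neg_inertia A"
    using inertia_add_square[OF A'(1) Ac _ z(1) A'(2) z(3)] by (simp_all add: e_def)
  hence "vec_space.rank n A' = Suc (vec_space.rank n A)"
    using inertia_sum_eq_rank[OF A'(1) sym] inertia_sum_eq_rank[OF Ac] by simp
  ultimately show ?thesis by blast
qed

lemma graph_matrices_nonempty:
  assumes "sym (parcs G)"
  shows "graph_matrices n G \<noteq> {}"
proof -
  have "mat n n (\<lambda>(i,j). if (i, j) \<in> parcs G then 1 else 0) \<in> graph_matrices n G"
    using assms by (auto simp: graph_matrices_def dest: symD intro!: eq_matI)
  thus ?thesis by blast
qed

lemma graph_matrices_ex_rank:
  assumes "sym (parcs G)" "min_rank n G \<le> m" "m \<le> n"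
  shows "\<exists>A\<in>graph_matrices n G. vec_space.rank n A = m"
  using assms(2,3)
proof (induction m rule: dec_induct)
  case base
  have "\<exists>k. \<exists>A\<in>graph_matrices n G. vec_space.rank n A = k"
    using graph_matrices_nonempty[OF assms(1)] by blast
  thus ?case unfolding min_rank_def by (rule LeastI_ex)
next
  case (step m)
  thus ?case using graph_matrices_Suc_rank by fastforce
qed

section \<open>Convexity of the stripes\<close>

text \<open>
  By the symmetry about \<open>m / 2\<close> it is enough to descend from the maximum of \<open>T\<close> to \<open>m / 2\<close>.
\<close>
lemma reflected_downset_is_interval:
  fixes T :: "nat set"
  assumes ne: "T \<noteq> {}" and le: "\<And>r. r \<in> T \<Longrightarrow> r \<le> m"
    and refl: "\<And>r. r \<in> T \<Longrightarrow> m - r \<in> T"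
    and down: "\<And>r. r \<in> T \<Longrightarrow> m < 2 * r \<Longrightarrow> r - 1 \<in> T"
  shows "\<exists>a b. T = {a..b}"
proof -
  have fin: "finite T" using le finite_nat_set_iff_bounded_le by blast
  define b where "b = Max T"
  have b: "b \<in> T" "\<And>r. r \<in> T \<Longrightarrow> r \<le> b" using ne fin by (auto simp: b_def)
  have upper: "r \<in> T" if "r \<le> b" "m \<le> 2 * r" for r
    using that
  proof (induction r rule: inc_induct)
    case base
    show ?case by (rule b)
  next
    case (step r)
    thus ?case using down[of "Suc r"] by simp
  qed
  have "T = {m - b..b}"
  proof (intro subset_antisym subsetI)
    fix r assume r: "r \<in> T"
    show "r \<in> {m - b..b}" using b(2)[OF r] b(2)[OF refl[OF r]] le[OF r] by auto
  next
    fix r assume r: "r \<in> {m - b..b}"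
    show "r \<in> T"
    proof (cases "m \<le> 2 * r")
      case True
      thus ?thesis using upper r by simp
    next
      case False
      hence "m - r \<in> T" using r le[OF b(1)] by (intro upper) auto
      from refl[OF this] show ?thesis using False by simp
    qed
  qed
  thus ?thesis by blast
qed

theorem corollary1p2:
  fixes n :: nat and G :: "nat pair_pre_digraph"
  assumes "graph_on n G"
    and "undirected_forest G"
  shows "inertia_convex_on_stripes n G"
  unfolding inertia_convex_on_stripes_def
proof (intro allI impI)
  fix m assume m: "min_rank n G \<le> m \<and> m \<le> n"
  have G: "pair_graph G" and V: "pverts G = {0..<n}" using assms(1) by (auto simp: graph_on_def)
  note symE = pair_graph_finite_sym_irrefl(2)[OF G] and loop = pair_graph_finite_sym_irrefl(3)[OF G]
  let ?S = "inertia_stripe n G m"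
  have sym: "A \<in> carrier_mat n n" "transpose_mat A = A" if "A \<in> graph_matrices n G" for A
    using that by (auto simp: graph_matrices_def)
  have stripe: "stripe m ?S"
    unfolding stripe_def
  proof (intro conjI ballI, goal_cases)
    case 1
    show ?case using graph_matrices_ex_rank[OF symE, of n m] m by (auto simp: inertia_stripe_def)
  next
    case (2 rs)
    then obtain A where A: "A \<in> graph_matrices n G" "vec_space.rank n A = m" "rs = pin A"
      by (auto simp: inertia_stripe_def)
    have "pin (- A) \<in> ?S"
      using graph_matrices_uminus[OF A(1)] inertia_uminus(3)[OF sym[OF A(1)]] A(2)
      by (auto simp: inertia_stripe_def)
    thus ?case
      using inertia_uminus[OF sym[OF A(1)]] inertia_sum_eq_rank[OF sym[OF A(1)]] A
      by (simp add: pin_def)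
  qed
  have flip: "r - 1 \<in> fst ` ?S" if r: "r \<in> fst ` ?S" "m < 2 * r" for r
  proof -
    obtain A where A: "A \<in> graph_matrices n G" "vec_space.rank n A = m" "r = pos_inertia A"
      using r(1) by (auto simp: inertia_stripe_def pin_def)
    have "neg_inertia A < pos_inertia A"
      using inertia_sum_eq_rank[OF sym[OF A(1)]] A r(2) by simp
    moreover have "\<exists>v\<in>U. \<forall>a\<in>U. \<forall>b\<in>U. (v, a) \<in> parcs G \<longrightarrow> (v, b) \<in> parcs G \<longrightarrow> a = b"
      if "U \<subseteq> {..<n}" "U \<noteq> {}" for U
      using forest_subset_has_leaf[OF G assms(2)] that V by (metis lessThan_atLeast0)
    ultimately obtain A' where A': "A' \<in> graph_matrices n G"
      "pos_inertia A = Suc (pos_inertia A')" "neg_inertia A' = Suc (neg_inertia A)"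
      using forest_flip_positive_square[OF symE loop, of n "{0..<n}" A] A(1)
      unfolding graph_matrices_eq_matrices_on by (auto simp: lessThan_atLeast0)
    have "vec_space.rank n A' = m"
      using inertia_sum_eq_rank[OF sym[OF A(1)]] inertia_sum_eq_rank[OF sym[OF A'(1)]] A A' by simp
    hence "pin A' \<in> ?S" using A'(1) by (auto simp: inertia_stripe_def)
    thus ?thesis using A A' by (force simp: pin_def)
  qed
  have "\<exists>a b. fst ` ?S = {a..b}"
  proof (rule reflected_downset_is_interval[OF _ _ _ flip])
    show "fst ` ?S \<noteq> {}" using stripe by (simp add: stripe_def)
    fix r assume "r \<in> fst ` ?S"
    then obtain s where rs: "(r, s) \<in> ?S" by auto
    have "\<forall>(r, s)\<in>?S. (s, r) \<in> ?S \<and> r + s = m" using stripe by (simp add: stripe_def)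
    from bspec[OF this rs] have s: "(s, r) \<in> ?S" "r + s = m" by simp_all
    show "r \<le> m" using s(2) by simp
    have "m - r = fst (s, r)" using s(2) by simp
    thus "m - r \<in> fst ` ?S" using s(1) by (rule image_eqI)
  qed
  thus "convex_stripe m ?S" using stripe by (simp add: convex_stripe_def)
qed

end
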